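(* Let $r\ge 1$ and $n\geq 4r^2$ be integers and let $G\in\{\mathrm{A}_{n,r},\mathrm{S}_{n,r}\}$. Then $\mathcal{G}(G)\leq \frac{17}{10}\, b(G)$.
   Context: $\mathrm{S}_{n,r}$ and $\mathrm{A}_{n,r}$ denote $\mathrm{S}_n$ and $\mathrm{A}_n$ acting naturally on the set $\binom{[n]}{r}$ of $r$-subsets of $[n]=\{1,\dots,n\}$. For a finite permutation group $G$ on $\Omega$, $b(G)$ is the minimum size of a subset of $\Omega$ with trivial pointwise stabiliser. The greedy algorithm builds $\beta_1,\beta_2,\dots$ where each $\beta_i$ lies in a largest orbit of the pointwise stabiliser of $\{\beta_1,\dots,\beta_{i-1}\}$, stopping when this stabiliser is trivial; $\mathcal{G}(G)$ is the maximum size of a base produced this way over all choices. *)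

theory Defs
  imports Complex_Main "HOL-Combinatorics.Permutations"
begin

text \<open>Generic setting: a group of permutations G (a set of group elements) acting on a
  finite set Omega via act. The induced permutation group on Omega is the image of G.\<close>

definition ptstab :: "'g set \<Rightarrow> ('g \<Rightarrow> 'x \<Rightarrow> 'x) \<Rightarrow> 'x set \<Rightarrow> 'g set" where
  "ptstab G act S = {g \<in> G. \<forall>x\<in>S. act g x = x}"

definition acts_trivially :: "'g set \<Rightarrow> ('g \<Rightarrow> 'x \<Rightarrow> 'x) \<Rightarrow> 'x set \<Rightarrow> bool" where
  "acts_trivially H act Omega \<longleftrightarrow> (\<forall>h\<in>H. \<forall>x\<in>Omega. act h x = x)"

definition is_base :: "'g set \<Rightarrow> ('g \<Rightarrow> 'x \<Rightarrow> 'x) \<Rightarrow> 'x set \<Rightarrow> 'x set \<Rightarrow> bool" where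
  "is_base G act Omega B \<longleftrightarrow> B \<subseteq> Omega \<and> acts_trivially (ptstab G act B) act Omega"

definition base_size :: "'g set \<Rightarrow> ('g \<Rightarrow> 'x \<Rightarrow> 'x) \<Rightarrow> 'x set \<Rightarrow> nat" where
  "base_size G act Omega = (LEAST k. \<exists>B. finite B \<and> card B = k \<and> is_base G act Omega B)"

definition orbit_of :: "'g set \<Rightarrow> ('g \<Rightarrow> 'x \<Rightarrow> 'x) \<Rightarrow> 'x \<Rightarrow> 'x set" where
  "orbit_of H act x = (\<lambda>h. act h x) ` H"

definition in_largest_orbit :: "'g set \<Rightarrow> ('g \<Rightarrow> 'x \<Rightarrow> 'x) \<Rightarrow> 'x set \<Rightarrow> 'x \<Rightarrow> bool" where
  "in_largest_orbit H act Omega x \<longleftrightarrow> x \<in> Omega \<and>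
     (\<forall>y\<in>Omega. card (orbit_of H act y) \<le> card (orbit_of H act x))"

definition greedy_base :: "'g set \<Rightarrow> ('g \<Rightarrow> 'x \<Rightarrow> 'x) \<Rightarrow> 'x set \<Rightarrow> 'x list \<Rightarrow> bool" where
  "greedy_base G act Omega bs \<longleftrightarrow>
     (\<forall>i < length bs.
        \<not> acts_trivially (ptstab G act (set (take i bs))) act Omega \<and>
        in_largest_orbit (ptstab G act (set (take i bs))) act Omega (bs ! i)) \<and>
     acts_trivially (ptstab G act (set bs)) act Omega"

definition greedy_size :: "'g set \<Rightarrow> ('g \<Rightarrow> 'x \<Rightarrow> 'x) \<Rightarrow> 'x set \<Rightarrow> nat" where
  "greedy_size G act Omega = Max (length ` {bs. greedy_base G act Omega bs})"

definition Sym :: "nat \<Rightarrow> (nat \<Rightarrow> nat) set" where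
  "Sym n = {p. p permutes {1..n}}"

definition Alt :: "nat \<Rightarrow> (nat \<Rightarrow> nat) set" where
  "Alt n = {p. p permutes {1..n} \<and> evenperm p}"

definition rsubsets :: "nat \<Rightarrow> nat \<Rightarrow> nat set set" where
  "rsubsets n r = {A. A \<subseteq> {1..n} \<and> card A = r}"

definition set_act :: "(nat \<Rightarrow> nat) \<Rightarrow> nat set \<Rightarrow> nat set" where
  "set_act p A = p ` A"

end

theory Submission
  imports Defs "HOL-Library.Disjoint_Sets"
begin

text \<open>
The sets chosen so far cut \<open>{1..n}\<close> into cells, and the orbit of a set \<open>A\<close> under their stabiliser
consists (up to parity) of the sets meeting each cell in as many points as \<open>A\<close>. If \<open>A\<close> lies in a largest orbit
and meets cells of sizes \<open>s\<close>, \<open>s'\<close> in \<open>a\<close>, \<open>a'\<close> points, then exchanging a point yields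
\<open>a (s' + 1) \<le> (s + 1) (a' + 1)\<close>: the greedy choice is spread evenly.

Hence the process first chooses disjoint sets, until about \<open>r\<^sup>2\<close> points are uncovered. Then it takes
at most one point from each covered cell, always from the largest ones, while the uncovered cell
shrinks so quickly that it has at most 11 points once all other cells have size at most 3. From then
on a step either creates \<open>r\<close> new cells or decreases the largest cell size. Counting cells bounds the
number of steps by roughly \<open>2 n / r\<close> plus \<open>r\<close> and a constant, whereas every base has size at least
\<open>2 (n - 2) / (r + 1)\<close>, because, apart from one exceptional point, at most one point lies in no member and at most as many
points as there are members lie in exactly one.
\<close>

text \<open>Progress is measured by the number of cells, which starts at 1 and must reach
  \<open>n - 1\<close>; a step gains at most \<open>r\<close> cells. In the middle phase a step with
  \<open>a\<close> points in the uncovered cell may gain only \<open>r - a\<close> cells, but these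
  points are then covered, so the total shortfall is at most the number \<open>N < r * r + r\<close>
  of points uncovered at the start of that phase. In the last phase a step gaining fewer than
  \<open>r\<close> cells lowers the largest cell size, and the bound 11 keeps such steps few.

  The hypothesis \<open>n >= 4 * r^2\<close> makes the initial disjoint sets number at least
  \<open>3 * r\<close>. Since a step touches at most \<open>r\<close> cells, this supply sustains
  three steps on every level of the middle phase.

  For \<open>Alt n\<close> the orbit count is available only if two points stay together after the
  exchange. The last steps, with few cells of two points and none larger, therefore need an argument
  of their own.

  The ratio 17/10 is tight for these estimates only at small \<open>r\<close>, where additive
  constants weigh most: \<open>r <= 2\<close> is settled by the length bound \<open>n - 1\<close>,
  and \<open>r = 3\<close> relies on its middle phase being empty.\<close>

declare One_nat_def [simp del]

section \<open>Partitions and orbits of stabilisers\<close>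

definition refine :: "'a set set \<Rightarrow> 'a set \<Rightarrow> 'a set set" where
  "refine P A = ((\<lambda>c. c \<inter> A) ` P \<union> (\<lambda>c. c - A) ` P) - {{}}"

definition cells :: "nat \<Rightarrow> nat set list \<Rightarrow> nat set set" where
  "cells n bs = foldl refine {{1..n}} bs"

lemma cells_Nil [simp]: "cells n [] = {{1..n}}"
  by (simp add: cells_def)

lemma cells_snoc [simp]: "cells n (bs @ [b]) = refine (cells n bs) b"
  by (simp add: cells_def)

lemma cells_take_Suc: "i < length bs \<Longrightarrow> cells n (take (Suc i) bs) = refine (cells n (take i bs)) (bs ! i)"
  by (simp add: take_Suc_conv_app_nth)

lemma partition_on_refine:
  assumes "partition_on X P"
  shows "partition_on X (refine P A)"
proof (rule partition_onI)
  show "\<Union> (refine P A) = X"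
    using partition_onD1[OF assms] by (auto simp: refine_def)
  show "{} \<notin> refine P A" by (simp add: refine_def)
  show "disjnt p q" if pq: "p \<in> refine P A" "q \<in> refine P A" "p \<noteq> q" for p q
  proof -
    obtain c where c: "c \<in> P" "p = c \<inter> A \<or> p = c - A" using pq(1) unfolding refine_def by blast
    obtain d where d: "d \<in> P" "q = d \<inter> A \<or> q = d - A" using pq(2) unfolding refine_def by blast
    show ?thesis
      using partition_onD2[OF assms] c d pq(3) by (cases "c = d") (auto simp: disjnt_def disjoint_def)
  qed
qed

lemma partition_on_cells: "1 \<le> n \<Longrightarrow> partition_on {1..n} (cells n bs)"
proof (induction bs rule: rev_induct)
  case Nil
  then show ?case by (auto simp: partition_on_def)
qed (simp add: partition_on_refine)

lemma finite_cell: "partition_on X P \<Longrightarrow> finite X \<Longrightarrow> c \<in> P \<Longrightarrow> finite c"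
  by (metis Sup_upper finite_subset partition_onD1)

lemma card_cell_pos: "partition_on X P \<Longrightarrow> finite X \<Longrightarrow> c \<in> P \<Longrightarrow> 1 \<le> card c"
  by (metis One_nat_def Suc_leI card_gt_0_iff finite_cell partition_onD3)

lemma sum_card_Int_partition:
  assumes P: "partition_on X P" and X: "finite X" and A: "A \<subseteq> X"
  shows "(\<Sum>c\<in>P. card (c \<inter> A)) = card A"
proof -
  have "A = (\<Union>c\<in>P. c \<inter> A)" using partition_onD1[OF P] A by auto
  also have "card \<dots> = (\<Sum>c\<in>P. card (c \<inter> A))"
    using finite_elements[OF X P] finite_cell[OF P X] partition_onD2[OF P]
    by (intro card_UN_disjoint) (auto simp: disjoint_def)
  finally show ?thesis by simp
qed

lemma sum_card_partition:
  assumes P: "partition_on X P" and X: "finite X"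
  shows "(\<Sum>c\<in>P. card c) = card X"
proof -
  have "c \<inter> X = c" if "c \<in> P" for c using that partition_onD1[OF P] by auto
  then show ?thesis using sum_card_Int_partition[OF P X order_refl] by (simp cong: sum.cong)
qed

lemma card_partition_le:
  assumes P: "partition_on X P" and X: "finite X"
  shows "card P \<le> card X"
proof -
  have "(\<Sum>c\<in>P. 1) \<le> (\<Sum>c\<in>P. card c)"
    by (intro sum_mono card_cell_pos[OF P X])
  then show ?thesis using sum_card_partition[OF P X] by simp
qed

text \<open>Only a cell that meets both \<open>A\<close> and its complement yields two pieces; every
  other cell yields one. All later bounds on the number of steps come down to counting these cut
  cells.\<close>

lemma card_refine:
  assumes P: "partition_on X P" and X: "finite X"
  shows "card (refine P A) = card P + card {c \<in> P. c \<inter> A \<noteq> {} \<and> c - A \<noteq> {}}"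
proof -
  have fin: "finite P" using finite_elements[OF X P] .
  let ?I = "{c \<in> P. c \<inter> A \<noteq> {}}" and ?D = "{c \<in> P. c - A \<noteq> {}}"
  have same: "c = d" if "c \<in> P" "d \<in> P" "x \<in> c" "x \<in> d" for c d x
    using that partition_onD2[OF P] by (auto simp: disjoint_def)
  have inj1: "inj_on (\<lambda>c. c \<inter> A) ?I" and inj2: "inj_on (\<lambda>c. c - A) ?D"
    by (rule inj_onI, use same in blast)+
  have "p \<subseteq> A \<and> p \<noteq> {}" if "p \<in> (\<lambda>c. c \<inter> A) ` ?I" for p using that by auto
  moreover have "p \<inter> A = {}" if "p \<in> (\<lambda>c. c - A) ` ?D" for p using that by auto
  ultimately have disj: "(\<lambda>c. c \<inter> A) ` ?I \<inter> (\<lambda>c. c - A) ` ?D = {}" by blast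
  have "refine P A = (\<lambda>c. c \<inter> A) ` ?I \<union> (\<lambda>c. c - A) ` ?D"
    by (auto simp: refine_def)
  then have "card (refine P A) = card ((\<lambda>c. c \<inter> A) ` ?I) + card ((\<lambda>c. c - A) ` ?D)"
    using card_Un_disjoint[OF _ _ disj] fin by simp
  then have 1: "card (refine P A) = card ?I + card ?D"
    by (simp only: card_image[OF inj1] card_image[OF inj2])
  have 2: "card ?I + card ?D = card (?I \<union> ?D) + card (?I \<inter> ?D)"
    by (rule card_Un_Int) (simp_all add: fin)
  have "c \<inter> A \<noteq> {} \<or> c - A \<noteq> {}" if "c \<in> P" for c
    using that partition_onD3[OF P] by (cases "c \<subseteq> A") (auto simp: Int_absorb2)
  then have 3: "?I \<union> ?D = P" by blast
  have 4: "?I \<inter> ?D = {c \<in> P. c \<inter> A \<noteq> {} \<and> c - A \<noteq> {}}" by blast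
  show ?thesis using 1 2 unfolding 3 4 by simp
qed

lemma refine_cellE:
  assumes "p \<in> refine P A"
  obtains c where "c \<in> P" "p = c \<inter> A \<or> p = c - A" "p \<noteq> {}"
  using assms by (auto simp: refine_def)

lemma cell_cases:
  assumes "p \<in> cells n bs" "b \<in> set bs"
  shows "p \<subseteq> b \<or> p \<inter> b = {}"
  using assms
proof (induction bs arbitrary: p rule: rev_induct)
  case (snoc a bs)
  from snoc.prems obtain c where c: "c \<in> cells n bs" "p = c \<inter> a \<or> p = c - a"
    by (auto elim: refine_cellE)
  show ?case
  proof (cases "b = a")
    case False
    then have "c \<subseteq> b \<or> c \<inter> b = {}" using snoc.IH[OF c(1)] snoc.prems by simp
    then show ?thesis using c by blast
  qed (use c in auto)
qed simp

text \<open>Cells are Boolean combinations of the listed sets, listed sets are unions of cells, and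
  a bijection respects both operations. So the stabiliser depends on the cells alone.\<close>

lemma image_fixes_cells:
  assumes h: "h permutes {1..n}" and bs: "\<forall>b\<in>set bs. b \<subseteq> {1..n}" and n: "1 \<le> n"
  shows "(\<forall>b\<in>set bs. h ` b = b) \<longleftrightarrow> (\<forall>c\<in>cells n bs. h ` c = c)"
  using bs
proof (induction bs rule: rev_induct)
  case Nil
  then show ?case by (simp add: permutes_image[OF h])
next
  case (snoc a bs)
  have inj: "inj h" using h by (rule permutes_inj)
  have un: "\<Union> (cells n bs) = {1..n}" using partition_onD1[OF partition_on_cells[OF n]] by simp
  have IH: "(\<forall>b\<in>set bs. h ` b = b) \<longleftrightarrow> (\<forall>c\<in>cells n bs. h ` c = c)"
    using snoc by simp
  have "(h ` a = a \<and> (\<forall>c\<in>cells n bs. h ` c = c)) \<longleftrightarrow> (\<forall>p\<in>refine (cells n bs) a. h ` p = p)"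
  proof (intro iffI conjI ballI)
    fix p assume *: "h ` a = a \<and> (\<forall>c\<in>cells n bs. h ` c = c)" and "p \<in> refine (cells n bs) a"
    then obtain c where "c \<in> cells n bs" "p = c \<inter> a \<or> p = c - a" by (auto elim: refine_cellE)
    with * show "h ` p = p" using image_Int[OF inj, of c a] image_set_diff[OF inj, of c a] by auto
  next
    assume *: "\<forall>p\<in>refine (cells n bs) a. h ` p = p"
    have I: "h ` (c \<inter> a) = c \<inter> a" "h ` (c - a) = c - a" if "c \<in> cells n bs" for c
    proof -
      show "h ` (c \<inter> a) = c \<inter> a" using * that by (cases "c \<inter> a = {}") (auto simp: refine_def)
      show "h ` (c - a) = c - a" using * that by (cases "c - a = {}") (auto simp: refine_def)
    qed
    show "h ` c = c" if "c \<in> cells n bs" for c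
    proof -
      have "h ` c = h ` (c \<inter> a) \<union> h ` (c - a)" by blast
      also have "\<dots> = c" using I[OF that] by auto
      finally show ?thesis .
    qed
    have "a = (\<Union>c\<in>cells n bs. c \<inter> a)" using un snoc.prems by auto
    then have "h ` a = (\<Union>c\<in>cells n bs. h ` (c \<inter> a))" by (metis image_UN)
    also have "\<dots> = (\<Union>c\<in>cells n bs. c \<inter> a)" using I by simp
    also have "\<dots> = a" using un snoc.prems by auto
    finally show "h ` a = a" .
  qed
  then show ?case using IH by auto
qed

section \<open>Orbits as classes of sets with equal cell counts\<close>

definition same_profile :: "nat \<Rightarrow> nat set set \<Rightarrow> nat set \<Rightarrow> nat set set" where
  "same_profile n P A = {D. D \<subseteq> {1..n} \<and> (\<forall>c\<in>P. card (c \<inter> D) = card (c \<inter> A))}"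

lemma ptstab_set_act_iff:
  assumes "G \<subseteq> Sym n" "\<forall>b\<in>set bs. b \<subseteq> {1..n}" "1 \<le> n"
  shows "h \<in> ptstab G set_act (set bs) \<longleftrightarrow> h \<in> G \<and> (\<forall>c\<in>cells n bs. h ` c = c)"
  using image_fixes_cells[OF _ assms(2,3), of h] assms(1) by (auto simp: ptstab_def set_act_def Sym_def)

lemma orbit_subset_same_profile:
  assumes G: "G \<subseteq> Sym n" and bs: "\<forall>b\<in>set bs. b \<subseteq> {1..n}" and n: "1 \<le> n" and A: "A \<subseteq> {1..n}"
  shows "orbit_of (ptstab G set_act (set bs)) set_act A \<subseteq> same_profile n (cells n bs) A"
proof
  fix D assume "D \<in> orbit_of (ptstab G set_act (set bs)) set_act A"
  then obtain h where h: "h \<in> ptstab G set_act (set bs)" "D = h ` A"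
    by (auto simp: orbit_of_def set_act_def)
  have hp: "h permutes {1..n}" and hc: "\<forall>c\<in>cells n bs. h ` c = c"
    using h G ptstab_set_act_iff[OF G bs n] by (auto simp: Sym_def)
  have "card (c \<inter> D) = card (c \<inter> A)" if "c \<in> cells n bs" for c
  proof -
    have "c \<inter> D = h ` (c \<inter> A)" using hc that h(2) by (simp add: image_Int[OF permutes_inj[OF hp]])
    then show ?thesis by (simp add: card_image[OF permutes_inj_on[OF hp]])
  qed
  moreover have "D \<subseteq> {1..n}" using h(2) A permutes_image[OF hp] by blast
  ultimately show "D \<in> same_profile n (cells n bs) A" by (simp add: same_profile_def)
qed

text \<open>Colour each point by its cell and its membership in \<open>A\<close>, and again by its
  cell and its membership in \<open>D\<close>. Equal counts in each cell make the two colour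
  multisets equal, so a permutation carries one colouring to the other.\<close>

lemma ex_permutes_same_profile:
  assumes P: "partition_on {1..n} P" and A: "A \<subseteq> {1..n}" and D: "D \<in> same_profile n P A"
  shows "\<exists>p. p permutes {1..n} \<and> (\<forall>c\<in>P. p ` c = c) \<and> p ` A = D"
proof -
  \<comment> \<open>The set of cells through \<open>x\<close>, a singleton for \<open>x\<close> in
    \<open>{1..n}\<close>, is used as the colour so that no cell has to be chosen.\<close>
  define cl where "cl x = {c \<in> P. x \<in> c}" for x
  have DX: "D \<subseteq> {1..n}" using D by (simp add: same_profile_def)
  have cl_eq: "cl x = {c}" if "c \<in> P" "x \<in> c" for x c
    using that partition_onD2[OF P] by (auto simp: cl_def disjoint_def)
  have ex: "\<exists>c\<in>P. x \<in> c" if "x \<in> {1..n}" for x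
    using that partition_onD1[OF P] by auto
  have cnt: "card {x \<in> {1..n}. (cl x, x \<in> A) = lb} = card {x \<in> {1..n}. (cl x, x \<in> D) = lb}" for lb
  proof (cases "\<exists>c\<in>P. fst lb = {c}")
    case True
    then obtain c b where c: "c \<in> P" "lb = ({c}, b)" by (cases lb) auto
    have cX: "c \<subseteq> {1..n}" using c(1) partition_onD1[OF P] by auto
    have eq: "{x \<in> {1..n}. (cl x, x \<in> E) = lb} = (if b then c \<inter> E else c - E)" for E
    proof -
      have "cl x = {c} \<longleftrightarrow> x \<in> c" for x
        using cl_eq[OF c(1), of x] by (auto simp: cl_def)
      then show ?thesis using cX c(2) by auto
    qed
    have fc: "finite c" using finite_cell[OF P _ c(1)] by simp
    have "card (c \<inter> D) = card (c \<inter> A)" using D c(1) by (simp add: same_profile_def)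
    then show ?thesis unfolding eq using fc by (simp add: card_Diff_subset_Int)
  next
    case False
    then have "{x \<in> {1..n}. (cl x, x \<in> E) = lb} = {}" for E
      using ex cl_eq by fastforce
    then show ?thesis by metis
  qed
  have mset: "image_mset (\<lambda>x. (cl x, x \<in> A)) (mset_set {1..n}) = image_mset (\<lambda>x. (cl x, x \<in> D)) (mset_set {1..n})"
  proof (rule multiset_eqI)
    fix lb
    have "count (image_mset (\<lambda>x. (cl x, x \<in> E)) (mset_set {1..n})) lb = card {x \<in> {1..n}. (cl x, x \<in> E) = lb}" for E
      by (simp add: count_image_mset_eq_card_vimage)
    then show "count (image_mset (\<lambda>x. (cl x, x \<in> A)) (mset_set {1..n})) lb
      = count (image_mset (\<lambda>x. (cl x, x \<in> D)) (mset_set {1..n})) lb" using cnt by simp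
  qed
  obtain p where
    p: "p permutes {1..n}" "\<forall>x\<in>{1..n}. (cl x, x \<in> A) = (cl (p x), p x \<in> D)"
    by (rule image_mset_eq_implies_permutes[OF finite_atLeastAtMost mset])
  have pc: "p ` c = c" if "c \<in> P" for c
  proof -
    have cX: "c \<subseteq> {1..n}" using that partition_onD1[OF P] by auto
    have "p ` c \<subseteq> c"
    proof
      fix y assume "y \<in> p ` c"
      then obtain x where x: "x \<in> c" "y = p x" by auto
      have "(cl x, x \<in> A) = (cl (p x), p x \<in> D)" using p(2) x(1) cX by blast
      then have "cl y = {c}" using cl_eq[OF that x(1)] x(2) by simp
      then show "y \<in> c" by (auto simp: cl_def)
    qed
    moreover have "finite c" using finite_cell[OF P _ that] by simp
    ultimately show ?thesis
      by (metis card_image card_subset_eq permutes_inj_on[OF p(1)])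
  qed
  have "p ` A = D"
  proof
    show "p ` A \<subseteq> D" using p A by auto
    show "D \<subseteq> p ` A"
    proof
      fix y assume y: "y \<in> D"
      then obtain x where "x \<in> {1..n}" "y = p x" using DX permutes_image[OF p(1)] by blast
      then show "y \<in> p ` A" using p(2) y by auto
    qed
  qed
  then show ?thesis using p(1) pc by blast
qed

lemma same_profile_subset_orbit:
  assumes G: "Alt n \<subseteq> G" "G \<subseteq> Sym n" and bs: "\<forall>b\<in>set bs. b \<subseteq> {1..n}" and n: "1 \<le> n"
    and A: "A \<subseteq> {1..n}" and e: "e \<in> refine (cells n bs) A" "2 \<le> card e"
  shows "same_profile n (cells n bs) A \<subseteq> orbit_of (ptstab G set_act (set bs)) set_act A"
proof
  fix D assume D: "D \<in> same_profile n (cells n bs) A"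
  note P = partition_on_cells[OF n, of bs]
  obtain p where p: "p permutes {1..n}" "\<forall>c\<in>cells n bs. p ` c = c" "p ` A = D"
    using ex_permutes_same_profile[OF P A D] by blast
  obtain z w where zw: "z \<in> e" "w \<in> e" "z \<noteq> w"
    using e(2) by (metis One_nat_def card_le_Suc0_iff_eq card.infinite not_less_eq_eq numeral_2_eq_2 zero_le_one)
  obtain c where c: "c \<in> cells n bs" "e = c \<inter> A \<or> e = c - A" using e(1) by (auto elim: refine_cellE)
  let ?t = "transpose z w"
  have cX: "c \<subseteq> {1..n}" using c(1) partition_onD1[OF P] by auto
  have tp: "?t permutes {1..n}" using zw c cX by (intro permutes_swap_id) auto
  have timg: "?t ` S = S" if "z \<in> S \<longleftrightarrow> w \<in> S" for S
    using that by (auto simp: transpose_def)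
  have tA: "?t ` A = A" using zw c by (intro timg) auto
  have tc: "?t ` d = d" if "d \<in> cells n bs" for d
  proof (intro timg)
    show "z \<in> d \<longleftrightarrow> w \<in> d" using that c zw partition_onD2[OF P] by (auto simp: disjoint_def)
  qed
  have perm: "permutation p" "permutation ?t"
    using p(1) tp permutation_permutes[of p] permutation_permutes[of ?t] by blast+
  \<comment> \<open>The transposition preserves \<open>A\<close> and every cell, so applying it
    before \<open>p\<close> changes the parity but none of the images that matter.\<close>
  define q where "q = (if evenperm p then p else p \<circ> ?t)"
  have q: "q permutes {1..n}" using p(1) tp by (simp add: q_def permutes_compose)
  have qimg: "q ` S = p ` S" if "?t ` S = S" for S
    using image_comp[of p ?t S] that by (simp add: q_def)
  have qc: "\<forall>d\<in>cells n bs. q ` d = d" "q ` A = D"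
    using p qimg tA tc by simp_all
  have "evenperm q"
    using perm zw(3) by (auto simp: q_def evenperm_comp evenperm_swap)
  then have "q \<in> G" using q G by (auto simp: Alt_def)
  then have "q \<in> ptstab G set_act (set bs)" using qc(1) ptstab_set_act_iff[OF G(2) bs n] by blast
  then show "D \<in> orbit_of (ptstab G set_act (set bs)) set_act A"
    using qc(2) by (auto simp: orbit_of_def set_act_def)
qed

text \<open>Double counting of the pairs that arise from each other by exchanging
  a point of \<open>c\<close> for a point of \<open>d\<close>.\<close>

lemma same_profile_exchange:
  assumes P: "partition_on {1..n} P" and A: "A \<subseteq> {1..n}"
    and cd: "c \<in> P" "d \<in> P" "c \<noteq> d" and x: "x \<in> c \<inter> A" and y: "y \<in> d - A"
  shows "card (same_profile n P A) * (card (c \<inter> A) * card (d - A))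
       = card (same_profile n P (insert y (A - {x}))) * ((card (c - A) + 1) * (card (d \<inter> A) + 1))"
proof -
  let ?A' = "insert y (A - {x})"
  let ?X = "same_profile n P A" and ?Y = "same_profile n P ?A'"
  define E where "E = (SIGMA D:?X. (c \<inter> D) \<times> (d - D))"
  define F where "F = (SIGMA D:?Y. (c - D) \<times> (d \<inter> D))"
  have fin: "finite c" "finite d" using finite_cell[OF P] cd by auto
  have cdX: "c \<subseteq> {1..n}" "d \<subseteq> {1..n}" using cd partition_onD1[OF P] by auto
  have disj: "c \<inter> d = {}" using cd partition_onD2[OF P] by (auto simp: disjoint_def)
  have finX: "finite (same_profile n P S)" for S
    by (rule finite_subset[of _ "Pow {1..n}"]) (auto simp: same_profile_def)
  have swap: "card (c \<inter> insert v (D - {u})) + 1 = card (c \<inter> D)" 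
      "card (d \<inter> insert v (D - {u})) = card (d \<inter> D) + 1"
      "\<And>e. e \<in> P \<Longrightarrow> e \<noteq> c \<Longrightarrow> e \<noteq> d \<Longrightarrow> e \<inter> insert v (D - {u}) = e \<inter> D"
    if "u \<in> c" "u \<in> D" "v \<in> d" "v \<notin> D" for u v D
  proof -
    have "c \<inter> insert v (D - {u}) = (c \<inter> D) - {u}" using that disj by auto
    then show "card (c \<inter> insert v (D - {u})) + 1 = card (c \<inter> D)"
      using that fin card_Suc_Diff1[of "c \<inter> D" u] by simp
    have "d \<inter> insert v (D - {u}) = insert v (d \<inter> D)" using that disj by auto
    then show "card (d \<inter> insert v (D - {u})) = card (d \<inter> D) + 1" using that fin by simp
    show "e \<inter> insert v (D - {u}) = e \<inter> D" if "e \<in> P" "e \<noteq> c" "e \<noteq> d" for e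
    proof -
      have "u \<notin> e" "v \<notin> e" using that \<open>u \<in> c\<close> \<open>v \<in> d\<close> cd partition_onD2[OF P] by (auto simp: disjoint_def)
      then show ?thesis by auto
    qed
  qed
  have xy: "x \<in> c" "x \<in> A" "y \<in> d" "y \<notin> A" using x y by auto
  note sA = swap[OF xy]
  have to: "insert v (D - {u}) \<in> ?Y" if D: "D \<in> ?X" and u: "u \<in> c" "u \<in> D" and v: "v \<in> d" "v \<notin> D" for D u v
  proof -
    note sD = swap[of u D v, OF u v]
    have "card (e \<inter> insert v (D - {u})) = card (e \<inter> ?A')" if "e \<in> P" for e
    proof -
      have De: "card (f \<inter> D) = card (f \<inter> A)" if "f \<in> P" for f
        using D that by (simp add: same_profile_def)
      consider "e = c" | "e = d" | "e \<noteq> c" "e \<noteq> d" by blast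
      then show ?thesis
      proof cases
        case 1
        show ?thesis unfolding 1 using sD(1) sA(1) De[OF cd(1)] by linarith
      next
        case 2
        show ?thesis unfolding 2 using sD(2) sA(2) De[OF cd(2)] by linarith
      next
        case 3
        then show ?thesis using sD(3)[OF \<open>e \<in> P\<close>] sA(3)[OF \<open>e \<in> P\<close>] De[OF \<open>e \<in> P\<close>] by metis
      qed
    qed
    moreover have "insert v (D - {u}) \<subseteq> {1..n}" using D v cdX by (auto simp: same_profile_def)
    ultimately show ?thesis by (simp add: same_profile_def)
  qed
  have fro: "insert u (D - {v}) \<in> ?X" if D: "D \<in> ?Y" and u: "u \<in> c" "u \<notin> D" and v: "v \<in> d" "v \<in> D" for D u v
  proof -
    let ?D = "insert u (D - {v})"
    have "u \<noteq> v" using u v disj by auto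
    then have bk: "insert v (?D - {u}) = D" "u \<in> ?D" "v \<notin> ?D" using u v by auto
    note sD = swap[of u ?D v, OF u(1) bk(2) v(1) bk(3), unfolded bk(1)]
    have "card (e \<inter> ?D) = card (e \<inter> A)" if "e \<in> P" for e
    proof -
      have De: "card (f \<inter> D) = card (f \<inter> ?A')" if "f \<in> P" for f
        using D that by (simp only: same_profile_def mem_Collect_eq)
      consider "e = c" | "e = d" | "e \<noteq> c" "e \<noteq> d" by blast
      then show ?thesis
      proof cases
        case 1
        show ?thesis unfolding 1 using sD(1) sA(1) De[OF cd(1)] by linarith
      next
        case 2
        show ?thesis unfolding 2 using sD(2) sA(2) De[OF cd(2)] by linarith
      next
        case 3
        then show ?thesis using sD(3)[OF \<open>e \<in> P\<close>] sA(3)[OF \<open>e \<in> P\<close>] De[OF \<open>e \<in> P\<close>] by metis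
      qed
    qed
    moreover have "?D \<subseteq> {1..n}" using D u cdX by (auto simp: same_profile_def)
    ultimately show ?thesis by (simp add: same_profile_def)
  qed
  have "bij_betw (\<lambda>(D, u, v). (insert v (D - {u}), u, v)) E F"
  proof (rule bij_betw_byWitness[where f' = "\<lambda>(D, u, v). (insert u (D - {v}), u, v)"])
    show "\<forall>a\<in>E. (\<lambda>(D, u, v). (insert u (D - {v}), u, v)) ((\<lambda>(D, u, v). (insert v (D - {u}), u, v)) a) = a"
      by (auto simp: E_def)
    show "\<forall>a\<in>F. (\<lambda>(D, u, v). (insert v (D - {u}), u, v)) ((\<lambda>(D, u, v). (insert u (D - {v}), u, v)) a) = a"
      by (auto simp: F_def)
    show "(\<lambda>(D, u, v). (insert v (D - {u}), u, v)) ` E \<subseteq> F"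
      using to disj by (auto simp: E_def F_def)
    show "(\<lambda>(D, u, v). (insert u (D - {v}), u, v)) ` F \<subseteq> E"
      using fro disj by (auto simp: E_def F_def)
  qed
  then have "card E = card F" by (rule bij_betw_same_card)
  moreover have "card E = card ?X * (card (c \<inter> A) * card (d - A))"
  proof -
    have "card E = (\<Sum>D\<in>?X. card ((c \<inter> D) \<times> (d - D)))"
      unfolding E_def using finX fin by (intro card_SigmaI) auto
    also have "\<dots> = (\<Sum>D\<in>?X. card (c \<inter> A) * card (d - A))"
      using cd fin by (intro sum.cong) (auto simp: same_profile_def card_cartesian_product card_Diff_subset_Int)
    finally show ?thesis by simp
  qed
  moreover have "card F = card ?Y * ((card (c - A) + 1) * (card (d \<inter> A) + 1))"
  proof -
    have *: "card (c - ?A') = card (c - A) + 1"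
    proof -
      have "c - ?A' = insert x (c - A)" using x y disj by auto
      then show ?thesis using x fin by simp
    qed
    have "card F = (\<Sum>D\<in>?Y. card ((c - D) \<times> (d \<inter> D)))"
      unfolding F_def using finX fin by (intro card_SigmaI) auto
    also have "\<dots> = (\<Sum>D\<in>?Y. card (c - ?A') * card (d \<inter> ?A'))"
      using cd fin by (intro sum.cong) (auto simp: same_profile_def card_cartesian_product card_Diff_subset_Int)
    finally show ?thesis using * sA x y by simp
  qed
  ultimately show ?thesis by simp
qed

text \<open>With \<open>s\<close>, \<open>a\<close> and \<open>s'\<close>, \<open>a'\<close> the
  sizes of \<open>c\<close>, \<open>c \<inter> A\<close>, \<open>d\<close>,
  \<open>d \<inter> A\<close>, comparing orbit sizes gives
  \<open>a * (s' - a') <= (s - a + 1) * (a' + 1)\<close>. The products \<open>a * a'\<close> cancel,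
  which leaves the inequality used here.\<close>

definition exchange_optimal :: "'a set set \<Rightarrow> 'a set \<Rightarrow> bool" where
  "exchange_optimal P A \<longleftrightarrow> (\<forall>c\<in>P. \<forall>d\<in>P. \<forall>x\<in>c \<inter> A. \<forall>y\<in>d - A. c \<noteq> d \<longrightarrow>
     (\<exists>e\<in>refine P (insert y (A - {x})). 2 \<le> card e) \<longrightarrow>
     card (c \<inter> A) * (card d + 1) \<le> (card c + 1) * (card (d \<inter> A) + 1))"

lemma rsubsets_subset: "A \<in> rsubsets n r \<Longrightarrow> A \<subseteq> {1..n}"
  by (simp add: rsubsets_def)

text \<open>The proviso that some cell of the refinement keeps two points is what makes the orbit of
  the exchanged set as large under \<open>Alt n\<close> as under \<open>Sym n\<close>: a transposition inside such a cell
  corrects the parity.\<close>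

lemma largest_orbit_exchange_optimal:
  assumes G: "Alt n \<subseteq> G" "G \<subseteq> Sym n" and bs: "\<forall>b\<in>set bs. b \<subseteq> {1..n}" and n: "1 \<le> n"
    and A: "in_largest_orbit (ptstab G set_act (set bs)) set_act (rsubsets n r) A"
  shows "exchange_optimal (cells n bs) A"
  unfolding exchange_optimal_def
proof (intro ballI impI)
  fix c d x y
  assume cd: "c \<in> cells n bs" "d \<in> cells n bs" "c \<noteq> d" and x: "x \<in> c \<inter> A" and y: "y \<in> d - A"
    and "\<exists>e\<in>refine (cells n bs) (insert y (A - {x})). 2 \<le> card e"
  then obtain e where e: "e \<in> refine (cells n bs) (insert y (A - {x}))" "2 \<le> card e" by blast
  let ?P = "cells n bs" and ?B = "insert y (A - {x})"
  let ?orb = "orbit_of (ptstab G set_act (set bs)) set_act"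
  note P = partition_on_cells[OF n, of bs]
  have AX: "A \<subseteq> {1..n}" "card A = r" using A by (auto simp: in_largest_orbit_def rsubsets_def)
  have finA: "finite A" using AX(1) finite_subset by blast
  have dX: "d \<subseteq> {1..n}" using cd(2) partition_onD1[OF P] by auto
  have BX: "?B \<subseteq> {1..n}" using AX dX y by auto
  have "card ?B = r" using finA AX x y card_Suc_Diff1[of A x] by simp
  then have "card (?orb ?B) \<le> card (?orb A)"
    using A BX by (auto simp: in_largest_orbit_def rsubsets_def)
  moreover have fin: "finite (same_profile n ?P S)" for S
    by (rule finite_subset[of _ "Pow {1..n}"]) (auto simp: same_profile_def)
  have "card (same_profile n ?P ?B) \<le> card (?orb ?B)"
    by (rule card_mono[OF finite_subset[OF orbit_subset_same_profile[OF G(2) bs n BX] fin]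
          same_profile_subset_orbit[OF G bs n BX e]])
  moreover have "card (?orb A) \<le> card (same_profile n ?P A)"
    by (rule card_mono[OF fin orbit_subset_same_profile[OF G(2) bs n AX(1)]])
  ultimately have le: "card (same_profile n ?P ?B) \<le> card (same_profile n ?P A)" by linarith
  have "A \<in> same_profile n ?P A" using AX by (simp add: same_profile_def)
  then have pos: "0 < card (same_profile n ?P A)" using fin card_gt_0_iff by blast
  have "card (same_profile n ?P A) * (card (c \<inter> A) * card (d - A))
      \<le> card (same_profile n ?P A) * ((card (c - A) + 1) * (card (d \<inter> A) + 1))"
    unfolding same_profile_exchange[OF P AX(1) cd x y] by (rule mult_right_mono[OF le]) simp
  then have main: "card (c \<inter> A) * card (d - A) \<le> (card (c - A) + 1) * (card (d \<inter> A) + 1)"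
    using pos by simp
  have fcd: "finite c" "finite d" using finite_cell[OF P] cd by auto
  have "card c = card (c \<inter> A) + card (c - A)" "card d = card (d \<inter> A) + card (d - A)"
    using fcd by (simp_all add: card_Int_Diff)
  then show "card (c \<inter> A) * (card d + 1) \<le> (card c + 1) * (card (d \<inter> A) + 1)"
    using main by (simp add: algebra_simps)
qed

lemma id_in_ptstab: "Alt n \<subseteq> G \<Longrightarrow> id \<in> ptstab G set_act S"
proof -
  assume "Alt n \<subseteq> G"
  moreover have "id \<in> Alt n" by (simp add: Alt_def permutes_id)
  ultimately show ?thesis by (auto simp: ptstab_def set_act_def)
qed

text \<open>A nontrivial action has an orbit with two members, so a largest orbit has two as well
  and some \<open>g\<close> in the stabiliser moves \<open>A\<close>. Since \<open>g\<close> fixes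
  every cell, \<open>A\<close> is not a union of cells and must cut one. This is the progress that
  makes the process terminate.\<close>

lemma largest_orbit_splits:
  assumes G: "Alt n \<subseteq> G" "G \<subseteq> Sym n" and bs: "\<forall>b\<in>set bs. b \<subseteq> {1..n}" and n: "1 \<le> n"
    and A: "in_largest_orbit (ptstab G set_act (set bs)) set_act (rsubsets n r) A"
    and nt: "\<not> acts_trivially (ptstab G set_act (set bs)) set_act (rsubsets n r)"
  shows "card (cells n bs) + 1 \<le> card (refine (cells n bs) A)"
proof -
  let ?P = "cells n bs" and ?H = "ptstab G set_act (set bs)"
  note P = partition_on_cells[OF n, of bs]
  have AX: "A \<subseteq> {1..n}" using A by (auto simp: in_largest_orbit_def rsubsets_def)
  obtain h D where hD: "h \<in> ?H" "D \<in> rsubsets n r" "set_act h D \<noteq> D"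
    using nt by (auto simp: acts_trivially_def)
  have DX: "D \<subseteq> {1..n}" using hD(2) by (rule rsubsets_subset)
  have "finite (orbit_of ?H set_act D)"
    by (rule finite_subset[OF orbit_subset_same_profile[OF G(2) bs n DX]],
        rule finite_subset[of _ "Pow {1..n}"]) (auto simp: same_profile_def)
  moreover have "{set_act h D, D} \<subseteq> orbit_of ?H set_act D"
  proof -
    have "set_act id D = D" by (simp add: set_act_def)
    then have "D \<in> orbit_of ?H set_act D"
      unfolding orbit_of_def using id_in_ptstab[OF G(1)] by (metis image_eqI)
    then show ?thesis using hD(1) by (simp add: orbit_of_def)
  qed
  ultimately have "2 \<le> card (orbit_of ?H set_act D)"
    using hD(3) by (metis card_2_iff card_mono)
  then have two: "2 \<le> card (orbit_of ?H set_act A)"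
    using A hD(2) by (force simp: in_largest_orbit_def)
  have "\<exists>g\<in>?H. g ` A \<noteq> A"
  proof (rule ccontr)
    assume "\<not> ?thesis"
    then have "orbit_of ?H set_act A \<subseteq> {A}" by (auto simp: orbit_of_def set_act_def)
    from card_mono[OF _ this] two show False by simp
  qed
  then obtain g where g: "g \<in> ?H" "g ` A \<noteq> A" by blast
  have gc: "g ` c = c" if "c \<in> ?P" for c using g(1) that ptstab_set_act_iff[OF G(2) bs n] by blast
  have "{c \<in> ?P. c \<inter> A \<noteq> {} \<and> c - A \<noteq> {}} \<noteq> {}"
  proof
    assume none: "{c \<in> ?P. c \<inter> A \<noteq> {} \<and> c - A \<noteq> {}} = {}"
    have "A = \<Union> {c \<in> ?P. c \<subseteq> A}"
    proof
      show "A \<subseteq> \<Union> {c \<in> ?P. c \<subseteq> A}"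
      proof
        fix a assume a: "a \<in> A"
        then obtain c where "c \<in> ?P" "a \<in> c" using AX partition_onD1[OF P] by blast
        then show "a \<in> \<Union> {c \<in> ?P. c \<subseteq> A}" using none a by blast
      qed
    qed auto
    moreover have "g ` \<Union> {c \<in> ?P. c \<subseteq> A} = \<Union> {c \<in> ?P. c \<subseteq> A}"
      unfolding image_Union using gc by simp
    ultimately show False using g(2) by metis
  qed
  moreover have "finite ?P" using finite_elements[OF _ P] by simp
  ultimately have "1 \<le> card {c \<in> ?P. c \<inter> A \<noteq> {} \<and> c - A \<noteq> {}}"
    by (simp add: Suc_le_eq card_gt_0_iff One_nat_def)
  then show ?thesis using card_refine[OF P, of A] by simp
qed

lemma ex_rsubset_separating:
  assumes "1 \<le> r" "r < n" "x \<in> {1..n}" "y \<in> {1..n}" "x \<noteq> y"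
  obtains D where "D \<in> rsubsets n r" "y \<in> D" "x \<notin> D"
proof -
  have "card ({1..n} - {x, y}) = n - 2" using assms by (simp add: card_Diff_subset)
  then have "r - 1 \<le> card ({1..n} - {x, y})" using assms by simp
  then obtain E where E: "E \<subseteq> {1..n} - {x, y}" "card E = r - 1"
    by (meson obtain_subset_with_card_n)
  have "finite E" using E(1) finite_subset by blast
  then have "card (insert y E) = r" using E assms by (subst card_insert_disjoint) auto
  then have "insert y E \<in> rsubsets n r" using E assms by (auto simp: rsubsets_def)
  then show thesis using that[of "insert y E"] E assms by auto
qed

section \<open>Lower bound for bases\<close>

text \<open>A single unseparated pair only yields an odd permutation, which \<open>Alt n\<close>
  does not contain; hence the excepted point. If no exception works, two unseparated pairs supply an
  even product of transpositions in the stabiliser.\<close>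

lemma trivial_ptstab_separates:
  assumes G: "Alt n \<subseteq> G" and r: "1 \<le> r" "r < n"
    and triv: "acts_trivially (ptstab G set_act S) set_act (rsubsets n r)"
  shows "\<exists>z. \<forall>x\<in>{1..n} - {z}. \<forall>y\<in>{1..n} - {z}. x \<noteq> y \<longrightarrow> (\<exists>b\<in>S. (x \<in> b) \<noteq> (y \<in> b))"
proof (rule ccontr)
  assume neg: "\<not> ?thesis"
  then have ex: "\<exists>x\<in>{1..n} - {z}. \<exists>y\<in>{1..n} - {z}. x \<noteq> y \<and> (\<forall>b\<in>S. (x \<in> b) = (y \<in> b))" for z
    by simp
  \<comment> \<open>The value 0 lies outside \<open>{1..n}\<close>, so nothing is excluded here. The
    second pair avoids \<open>y\<close>, so that \<open>g\<close> still sends \<open>y\<close> to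
    \<open>x\<close>.\<close>
  obtain x y where xy: "x \<in> {1..n}" "y \<in> {1..n}" "x \<noteq> y" "\<forall>b\<in>S. (x \<in> b) = (y \<in> b)"
    using ex[of 0] by blast
  obtain z w where zw: "z \<in> {1..n} - {y}" "w \<in> {1..n} - {y}" "z \<noteq> w" "\<forall>b\<in>S. (z \<in> b) = (w \<in> b)"
    using ex[of y] by blast
  define g where "g = transpose x y \<circ> transpose z w"
  have p: "transpose x y permutes {1..n}" "transpose z w permutes {1..n}"
    using permutes_swap_id[OF xy(1,2)] permutes_swap_id[of z "{1..n}" w] zw(1,2) by simp_all
  have "permutation (transpose x y)" "permutation (transpose z w)"
    by (simp_all add: permutation_swap_id)
  then have "evenperm g" using xy(3) zw(3) by (simp add: g_def evenperm_comp evenperm_swap)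
  moreover have "g permutes {1..n}" unfolding g_def using p by (rule permutes_compose[rotated])
  ultimately have "g \<in> G" using G by (auto simp: Alt_def)
  moreover have "g ` b = b" if "b \<in> S" for b
  proof -
    have "transpose u v ` b = b" if "u \<in> b \<longleftrightarrow> v \<in> b" for u v
      using that by (auto simp: transpose_def)
    then have "transpose x y ` b = b" "transpose z w ` b = b" using that xy(4) zw(4) by blast+
    then show ?thesis unfolding g_def image_comp[symmetric] by simp
  qed
  ultimately have "g \<in> ptstab G set_act S" by (simp add: ptstab_def set_act_def)
  moreover obtain D where D: "D \<in> rsubsets n r" "y \<in> D" "x \<notin> D"
    using ex_rsubset_separating[OF r xy(1-3)] .
  ultimately have "g ` D = D" using triv by (auto simp: acts_trivially_def set_act_def)
  moreover have "g y = x" using zw(1,2) by (auto simp: g_def transpose_def)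
  ultimately show False using D by blast
qed

text \<open>Separated points lie in different cells, and all points but one are pairwise separated.
  This is the terminal count against which the steps are measured.\<close>

lemma trivial_ptstab_card_cells:
  assumes G: "Alt n \<subseteq> G" and r: "1 \<le> r" "r < n"
    and triv: "acts_trivially (ptstab G set_act (set bs)) set_act (rsubsets n r)"
  shows "n - 1 \<le> card (cells n bs)"
proof -
  let ?P = "cells n bs"
  have P: "partition_on {1..n} ?P" using r by (intro partition_on_cells) simp
  obtain z where z: "\<forall>x\<in>{1..n} - {z}. \<forall>y\<in>{1..n} - {z}. x \<noteq> y \<longrightarrow> (\<exists>b\<in>set bs. (x \<in> b) \<noteq> (y \<in> b))"
    using trivial_ptstab_separates[OF G r triv] by blast
  have "\<forall>x\<in>{1..n}. \<exists>c\<in>?P. x \<in> c" using partition_onD1[OF P] by blast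
  then obtain f where f: "\<forall>x\<in>{1..n}. f x \<in> ?P \<and> x \<in> f x" by metis
  have "inj_on f ({1..n} - {z})"
  proof (rule inj_onI)
    fix x y assume xy: "x \<in> {1..n} - {z}" "y \<in> {1..n} - {z}" "f x = f y"
    have "(x \<in> b) = (y \<in> b)" if "b \<in> set bs" for b
    proof -
      have "f x \<in> ?P" "x \<in> f x" "y \<in> f x" using f xy by auto
      then show ?thesis using cell_cases[of "f x" n bs b] that by blast
    qed
    then show "x = y" using z xy by blast
  qed
  moreover have "f ` ({1..n} - {z}) \<subseteq> ?P" using f by auto
  moreover have "finite ?P" using finite_elements[OF _ P] by simp
  ultimately have "card ({1..n} - {z}) \<le> card ?P" by (rule card_inj_on_le)
  then show ?thesis by (cases "z \<in> {1..n}") (simp_all add: card_Diff_subset)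
qed

text \<open>Labelling each point by the members of \<open>B\<close> that contain it, at most one label is empty
  and at most \<open>card B\<close> labels are singletons.\<close>

lemma base_card_lower_bound:
  assumes G: "Alt n \<subseteq> G" and r: "1 \<le> r" "r < n"
    and B: "finite B" "is_base G set_act (rsubsets n r) B"
  shows "2 * (n - 2) \<le> card B * (r + 1)"
proof -
  have BX: "B \<subseteq> rsubsets n r" and triv: "acts_trivially (ptstab G set_act B) set_act (rsubsets n r)"
    using B(2) by (auto simp: is_base_def)
  obtain z where z: "\<forall>x\<in>{1..n} - {z}. \<forall>y\<in>{1..n} - {z}. x \<noteq> y \<longrightarrow> (\<exists>b\<in>B. (x \<in> b) \<noteq> (y \<in> b))"
    using trivial_ptstab_separates[OF G r triv] by blast
  define L where "L x = {b \<in> B. x \<in> b}" for x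
  define X where "X = {1..n} - {z}"
  have finX: "finite X" by (simp add: X_def)
  have cX: "n - 1 \<le> card X" unfolding X_def by (cases "z \<in> {1..n}") (simp_all add: card_Diff_subset)
  have inj: "inj_on L X"
  proof (rule inj_onI)
    fix x y assume xy: "x \<in> X" "y \<in> X" "L x = L y"
    have "(x \<in> b) = (y \<in> b)" if "b \<in> B" for b
    proof -
      have "b \<in> L x \<longleftrightarrow> b \<in> L y" using xy(3) by simp
      then show ?thesis using that by (simp add: L_def)
    qed
    then show "x = y" using z xy(1,2) unfolding X_def by blast
  qed
  have finL: "finite (L x)" for x using B(1) by (simp add: L_def)
  let ?E = "{x \<in> X. L x = {}}" and ?S = "{x \<in> X. card (L x) = 1}"
  have "card ?E \<le> 1"
  proof -
    have "x = y" if "x \<in> ?E" "y \<in> ?E" for x y using that inj_onD[OF inj, of x y] by simp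
    then show ?thesis using finX card_le_Suc0_iff_eq[of ?E] by (simp add: One_nat_def)
  qed
  moreover have "card ?S \<le> card B"
  proof -
    have "card ?S = card (L ` ?S)" by (rule card_image[symmetric]) (rule inj_on_subset[OF inj], auto)
    also have "L ` ?S \<subseteq> (\<lambda>b. {b}) ` B"
    proof
      fix l assume "l \<in> L ` ?S"
      then obtain x where x: "x \<in> ?S" "l = L x" by (elim imageE)
      then have "card l = 1" by simp
      then obtain b where b: "l = {b}" by (rule card_1_singletonE)
      then have "b \<in> L x" using x(2) by simp
      then have "b \<in> B" by (simp add: L_def)
      then show "l \<in> (\<lambda>b. {b}) ` B" unfolding b by (rule imageI)
    qed
    then have "card (L ` ?S) \<le> card ((\<lambda>b. {b}) ` B)" using B(1) by (intro card_mono) auto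
    also have "\<dots> = card B" by (simp add: card_image)
    finally show ?thesis .
  qed
  moreover have "2 * card X \<le> (\<Sum>x\<in>X. card (L x)) + card ?S + 2 * card ?E"
  proof -
    have "2 * card X = (\<Sum>x\<in>X. 2)" by simp
    also have "\<dots> \<le> (\<Sum>x\<in>X. card (L x) + (if card (L x) = 1 then 1 else 0) + (if L x = {} then 2 else 0))"
    proof (rule sum_mono)
      fix x
      have "L x = {} \<longleftrightarrow> card (L x) = 0" using finL by simp
      then show "2 \<le> card (L x) + (if card (L x) = 1 then 1 else 0) + (if L x = {} then 2 else 0)"
        by auto
    qed
    also have "\<dots> = (\<Sum>x\<in>X. card (L x)) + card ?S + 2 * card ?E"
      by (simp add: sum.distrib sum.If_cases finX Int_def)
    finally show ?thesis .
  qed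
  moreover have "(\<Sum>x\<in>X. card (L x)) \<le> card B * r"
  proof -
    have "(\<Sum>x\<in>X. card (L x)) = (\<Sum>b\<in>B. card {x \<in> X. x \<in> b})"
      unfolding L_def using sum_multicount_gen[OF finX B(1), of "\<lambda>x b. x \<in> b" "\<lambda>b. card {x \<in> X. x \<in> b}"] by simp
    also have "\<dots> \<le> (\<Sum>b\<in>B. r)"
    proof (rule sum_mono)
      fix b assume "b \<in> B"
      then have "b \<subseteq> {1..n}" "card b = r" using BX by (auto simp: rsubsets_def)
      moreover have "finite b" using \<open>b \<subseteq> {1..n}\<close> finite_subset by blast
      ultimately show "card {x \<in> X. x \<in> b} \<le> r" using card_mono[of b "{x \<in> X. x \<in> b}"] by auto
    qed
    finally show ?thesis by simp
  qed
  ultimately have "2 * (n - 1) \<le> card B * r + card B + 2" using cX by linarith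
  then show ?thesis by (simp add: algebra_simps)
qed

section \<open>Existence and length of greedy bases\<close>

definition greedy_prefix :: "'g set \<Rightarrow> ('g \<Rightarrow> 'x \<Rightarrow> 'x) \<Rightarrow> 'x set \<Rightarrow> 'x list \<Rightarrow> bool" where
  "greedy_prefix G act Omega bs \<longleftrightarrow>
     (\<forall>i < length bs.
        \<not> acts_trivially (ptstab G act (set (take i bs))) act Omega \<and>
        in_largest_orbit (ptstab G act (set (take i bs))) act Omega (bs ! i))"

lemma greedy_base_iff:
  "greedy_base G act Omega bs \<longleftrightarrow> greedy_prefix G act Omega bs \<and> acts_trivially (ptstab G act (set bs)) act Omega"
  unfolding greedy_base_def greedy_prefix_def by (rule refl)

lemma greedy_prefix_nth:
  "greedy_prefix G act Omega bs \<Longrightarrow> i < length bs \<Longrightarrow> bs ! i \<in> Omega"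
  by (simp add: greedy_prefix_def in_largest_orbit_def)

lemma greedy_prefix_subset:
  assumes "greedy_prefix G set_act (rsubsets n r) bs"
  shows "\<forall>b\<in>set (take i bs). b \<subseteq> {1..n}"
proof
  fix b assume "b \<in> set (take i bs)"
  then obtain j where "j < length bs" "b = bs ! j" by (auto simp: in_set_conv_nth dest!: in_set_takeD)
  then show "b \<subseteq> {1..n}" using rsubsets_subset[OF greedy_prefix_nth[OF assms]] by simp
qed

lemma greedy_prefix_card_cells:
  assumes G: "Alt n \<subseteq> G" "G \<subseteq> Sym n" and n: "1 \<le> n"
    and bs: "greedy_prefix G set_act (rsubsets n r) bs" and i: "i < length bs"
  shows "card (cells n (take i bs)) + 1 \<le> card (cells n (take (Suc i) bs))"
proof -
  have "\<not> acts_trivially (ptstab G set_act (set (take i bs))) set_act (rsubsets n r)"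
    "in_largest_orbit (ptstab G set_act (set (take i bs))) set_act (rsubsets n r) (bs ! i)"
    using bs i by (simp_all add: greedy_prefix_def)
  then show ?thesis
    unfolding cells_take_Suc[OF i] using largest_orbit_splits[OF G greedy_prefix_subset[OF bs] n] by blast
qed

lemma greedy_prefix_length:
  assumes G: "Alt n \<subseteq> G" "G \<subseteq> Sym n" and n: "1 \<le> n"
    and bs: "greedy_prefix G set_act (rsubsets n r) bs"
  shows "length bs \<le> n - 1"
proof -
  have "i \<le> length bs \<Longrightarrow> i + 1 \<le> card (cells n (take i bs))" for i
  proof (induction i)
    case (Suc i)
    then show ?case using greedy_prefix_card_cells[OF G n bs, of i] by simp
  qed simp
  from this[of "length bs"] show ?thesis
    using card_partition_le[OF partition_on_cells[OF n, of bs]] by simp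
qed

lemma ex_in_largest_orbit:
  assumes "finite Omega" "Omega \<noteq> {}"
  shows "\<exists>x. in_largest_orbit H act Omega x"
proof -
  let ?f = "\<lambda>x. card (orbit_of H act x)"
  have "Max (?f ` Omega) \<in> ?f ` Omega" using assms by (intro Max_in) auto
  then obtain x where "x \<in> Omega" "?f x = Max (?f ` Omega)" by auto
  then show ?thesis using assms by (auto simp: in_largest_orbit_def)
qed

text \<open>Without a complete run every prefix could be prolonged, against the length bound
  \<open>n - 1\<close>. The run also supplies the witness behind the \<open>LEAST\<close> in
  \<open>base_size\<close> and the nonemptiness behind the \<open>Max\<close> in
  \<open>greedy_size\<close>.\<close>

lemma ex_greedy_base:
  assumes G: "Alt n \<subseteq> G" "G \<subseteq> Sym n" and n: "1 \<le> n" "r \<le> n"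
  shows "\<exists>bs. greedy_base G set_act (rsubsets n r) bs"
proof (rule ccontr)
  assume none: "\<not> ?thesis"
  let ?Om = "rsubsets n r"
  have fin: "finite ?Om" by (rule finite_subset[of _ "Pow {1..n}"]) (auto simp: rsubsets_def)
  have ne: "?Om \<noteq> {}"
    using obtain_subset_with_card_n[of r "{1..n}"] n by (auto simp: rsubsets_def)
  have "\<exists>bs. length bs = k \<and> greedy_prefix G set_act ?Om bs" for k
  proof (induction k)
    case 0
    then show ?case by (simp add: greedy_prefix_def)
  next
    case (Suc k)
    then obtain bs where bs: "length bs = k" "greedy_prefix G set_act ?Om bs" by blast
    obtain b where b: "in_largest_orbit (ptstab G set_act (set bs)) set_act ?Om b"
      using ex_in_largest_orbit[OF fin ne] by blast
    have "\<not> acts_trivially (ptstab G set_act (set bs)) set_act ?Om"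
      using none bs greedy_base_iff by blast
    then have "greedy_prefix G set_act ?Om (bs @ [b])"
      using bs b by (auto simp: greedy_prefix_def nth_append less_Suc_eq)
    then show ?case using bs(1) by (intro exI[of _ "bs @ [b]"]) simp
  qed
  from this[of n] show False using greedy_prefix_length[OF G n(1)] n(1) by fastforce
qed

lemma greedy_size_attained:
  assumes G: "Alt n \<subseteq> G" "G \<subseteq> Sym n" and n: "1 \<le> n" "r \<le> n"
  obtains bs where "greedy_base G set_act (rsubsets n r) bs"
    "greedy_size G set_act (rsubsets n r) = length bs"
proof -
  let ?L = "length ` {bs. greedy_base G set_act (rsubsets n r) bs}"
  have "?L \<subseteq> {..n - 1}"
    using greedy_prefix_length[OF G n(1)] by (auto simp: greedy_base_iff)
  then have "finite ?L" by (rule finite_subset) simp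
  moreover have "?L \<noteq> {}" using ex_greedy_base[OF G n] by simp
  ultimately have "greedy_size G set_act (rsubsets n r) \<in> ?L"
    unfolding greedy_size_def by (rule Max_in)
  then show thesis using that by auto
qed

lemma base_size_lower_bound:
  assumes G: "Alt n \<subseteq> G" "G \<subseteq> Sym n" and r: "1 \<le> r" "r < n"
  shows "2 * (n - 2) \<le> base_size G set_act (rsubsets n r) * (r + 1)"
proof -
  let ?Q = "\<lambda>k. \<exists>B. finite B \<and> card B = k \<and> is_base G set_act (rsubsets n r) B"
  obtain bs where bs: "greedy_base G set_act (rsubsets n r) bs"
    using ex_greedy_base[OF G] r by (meson less_imp_le order.trans)
  have "set bs \<subseteq> rsubsets n r"
    using bs greedy_prefix_nth by (metis greedy_base_iff in_set_conv_nth subsetI)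
  then have "?Q (card (set bs))"
    using bs by (auto simp: is_base_def greedy_base_def)
  then have "?Q (base_size G set_act (rsubsets n r))"
    unfolding base_size_def by (rule LeastI)
  then obtain B where "finite B" "card B = base_size G set_act (rsubsets n r)"
    "is_base G set_act (rsubsets n r) B" by blast
  then show ?thesis using base_card_lower_bound[OF G(1) r, of B] by simp
qed

section \<open>A single greedy step\<close>

text \<open>This is \<open>exchange_optimal\<close> without its premises. The inequality is
  automatic for \<open>c = d\<close>, for \<open>c\<close> disjoint from \<open>A\<close> and for
  \<open>d\<close> inside \<open>A\<close>, so it is the parity proviso that has to be
  overcome.\<close>

definition balanced :: "'a set set \<Rightarrow> 'a set \<Rightarrow> bool" where
  "balanced P A \<longleftrightarrow> (\<forall>c\<in>P. \<forall>d\<in>P. card (c \<inter> A) * (card d + 1) \<le> (card c + 1) * (card (d \<inter> A) + 1))"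

lemma balancedD:
  "balanced P A \<Longrightarrow> c \<in> P \<Longrightarrow> d \<in> P \<Longrightarrow> card (c \<inter> A) * (card d + 1) \<le> (card c + 1) * (card (d \<inter> A) + 1)"
  by (simp add: balanced_def)

lemma partition_on_disjoint: "partition_on X P \<Longrightarrow> c \<in> P \<Longrightarrow> d \<in> P \<Longrightarrow> c \<noteq> d \<Longrightarrow> c \<inter> d = {}"
  using partition_onD2 by (fastforce simp: disjoint_def)

lemma card_touched_le:
  assumes P: "partition_on X P" and X: "finite X" and A: "A \<subseteq> X"
  shows "card {c \<in> P. c \<inter> A \<noteq> {}} \<le> card A"
proof -
  have fin: "finite P" using finite_elements[OF X P] .
  have "card {c \<in> P. c \<inter> A \<noteq> {}} = (\<Sum>c\<in>{c \<in> P. c \<inter> A \<noteq> {}}. 1)" by simp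
  also have "\<dots> \<le> (\<Sum>c\<in>{c \<in> P. c \<inter> A \<noteq> {}}. card (c \<inter> A))"
  proof (rule sum_mono)
    fix c assume c: "c \<in> {c \<in> P. c \<inter> A \<noteq> {}}"
    then have "finite c" using finite_cell[OF P X] by simp
    then have "0 < card (c \<inter> A)" using c by (simp add: card_gt_0_iff)
    then show "1 \<le> card (c \<inter> A)" by simp
  qed
  also have "\<dots> \<le> (\<Sum>c\<in>P. card (c \<inter> A))" using fin by (intro sum_mono2) auto
  also have "\<dots> = card A" by (rule sum_card_Int_partition[OF P X A])
  finally show ?thesis .
qed

lemma ex_untouched:
  assumes P: "partition_on X P" and X: "finite X" and A: "A \<subseteq> X"
    and S: "S \<subseteq> P" "card A < card S"
  shows "\<exists>c\<in>S. c \<inter> A = {}"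
proof (rule ccontr)
  assume "\<not> ?thesis"
  then have "S \<subseteq> {c \<in> P. c \<inter> A \<noteq> {}}" using S by blast
  then have "card S \<le> card {c \<in> P. c \<inter> A \<noteq> {}}"
    using finite_elements[OF X P] by (intro card_mono) simp_all
  then show False using card_touched_le[OF P X A] S(2) by linarith
qed

lemma in_refine_Diff: "c \<in> P \<Longrightarrow> c - A \<noteq> {} \<Longrightarrow> c - A \<in> refine P A"
  by (auto simp: refine_def)

lemma in_refine_Int: "c \<in> P \<Longrightarrow> c \<inter> A \<noteq> {} \<Longrightarrow> c \<inter> A \<in> refine P A"
  by (auto simp: refine_def)

text \<open>Either case of \<open>rich\<close> keeps two points together after any exchange: a cell
  of three points has two on the same side of the new set, and if more than \<open>card A\<close>
  cells have two points, the new set misses one of them.\<close>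

lemma exchange_optimal_balanced:
  assumes P: "partition_on X P" and X: "finite X" and A: "A \<subseteq> X"
    and opt: "exchange_optimal P A"
    and rich: "(\<exists>c\<in>P. 3 \<le> card c) \<or> card A < card {c \<in> P. 2 \<le> card c}"
  shows "balanced P A"
  unfolding balanced_def
proof (intro ballI)
  have left: "\<exists>e\<in>refine P A'. 2 \<le> card e" if A': "A' \<subseteq> X" "card A' = card A" for A'
    using rich
  proof
    assume "\<exists>c\<in>P. 3 \<le> card c"
    then obtain c where c: "c \<in> P" "3 \<le> card c" by blast
    have "card c = card (c \<inter> A') + card (c - A')"
      using finite_cell[OF P X c(1)] by (rule card_Int_Diff)
    then have "2 \<le> card (c \<inter> A') \<or> 2 \<le> card (c - A')" using c(2) by linarith
    then show ?thesis
    proof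
      assume 2: "2 \<le> card (c \<inter> A')"
      then have "c \<inter> A' \<noteq> {}" by auto
      then show ?thesis using in_refine_Int[OF c(1)] 2 by blast
    next
      assume 2: "2 \<le> card (c - A')"
      then have "c - A' \<noteq> {}" by (metis card.empty not_numeral_le_zero)
      then show ?thesis using in_refine_Diff[OF c(1)] 2 by blast
    qed
  next
    assume "card A < card {c \<in> P. 2 \<le> card c}"
    then obtain c where c: "c \<in> {c \<in> P. 2 \<le> card c}" "c \<inter> A' = {}"
      using ex_untouched[OF P X A'(1), of "{c \<in> P. 2 \<le> card c}"] A'(2) by auto
    then have "c - A' = c" "c \<noteq> {}" by auto
    then show ?thesis using in_refine_Diff[of c P A'] c by auto
  qed
  fix c d assume cd: "c \<in> P" "d \<in> P"
  have fin: "finite c" "finite d" "finite A" using finite_cell[OF P X] cd finite_subset[OF A X] by auto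
  have lec: "card (c \<inter> A) \<le> card c" using fin by (simp add: card_mono)
  consider "c = d" | "c \<inter> A = {}" | "d \<subseteq> A" | x y where "c \<noteq> d" "x \<in> c \<inter> A" "y \<in> d - A" by blast
  then show "card (c \<inter> A) * (card d + 1) \<le> (card c + 1) * (card (d \<inter> A) + 1)"
  proof cases
    case 1
    then show ?thesis by (simp add: algebra_simps)
  next
    case 2
    then show ?thesis by simp
  next
    case 3
    then have "d \<inter> A = d" by blast
    then show ?thesis using lec by (simp add: mult_right_mono)
  next
    case (4 x y)
    have "y \<in> X" using 4(3) cd(2) partition_onD1[OF P] by blast
    then have "insert y (A - {x}) \<subseteq> X" using A by auto
    moreover have "card (insert y (A - {x})) = card A"
      using 4 fin card_Suc_Diff1[of A x] by simp
    ultimately have "\<exists>e\<in>refine P (insert y (A - {x})). 2 \<le> card e" by (rule left)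
    then show ?thesis using opt cd 4 unfolding exchange_optimal_def by blast
  qed
qed

section \<open>Steps that cut \<open>r\<close> cells or lower the largest cell size\<close>

text \<open>If \<open>A\<close> swallowed a cell of \<open>m >= 2\<close> points, comparison with
  any cell \<open>d\<close> would give
  \<open>card d + 1 <= (1 + 1 / m) * (card (d \<inter> A) + 1)\<close>. Then \<open>A\<close> would
  fill at least a third of every cell, and summing contradicts \<open>big\<close>.\<close>

lemma touched_cell_split:
  assumes P: "partition_on X P" and X: "finite X" and A: "A \<subseteq> X" and bal: "balanced P A"
    and big: "3 * card A < card X" and c: "c \<in> P" "2 \<le> card c"
  shows "c - A \<noteq> {}"
proof
  assume "c - A = {}"
  then have cA: "c \<inter> A = c" by blast
  have "card d \<le> 3 * card (d \<inter> A)" if d: "d \<in> P" for d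
  proof -
    define m y where "m = card c" and "y = card (d \<inter> A) + 1"
    have 1: "m * (card d + 1) \<le> (m + 1) * y"
      using balancedD[OF bal c(1) d] by (simp add: cA m_def y_def)
    have "2 * (card d + 1) \<le> 3 * y"
    proof (cases "card d + 1 \<le> y")
      case False
      then obtain k where k: "card d + 1 = y + k" using le_Suc_ex nat_le_linear by blast
      have "m * k \<le> y" using 1 unfolding k by (simp add: algebra_simps)
      moreover have "2 * k \<le> m * k" using c(2) by (simp add: m_def)
      ultimately have "2 * k \<le> y" by (rule order_trans[rotated])
      then show ?thesis using k by presburger
    qed simp
    moreover have "1 \<le> card d" using card_cell_pos[OF P X d] .
    ultimately show ?thesis unfolding y_def by presburger
  qed
  then have "(\<Sum>d\<in>P. card d) \<le> (\<Sum>d\<in>P. 3 * card (d \<inter> A))" by (rule sum_mono)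
  then show False
    using big sum_card_partition[OF P X] sum_card_Int_partition[OF P X A] by (simp add: sum_distrib_left[symmetric])
qed

lemma card_A_le_card_split:
  assumes P: "partition_on X P" and X: "finite X" and A: "A \<subseteq> X"
    and one: "\<And>c. c \<in> P \<Longrightarrow> card (c \<inter> A) \<le> 1"
    and split: "\<And>c. c \<in> P \<Longrightarrow> card (c \<inter> A) = 1 \<Longrightarrow> c - A \<noteq> {}"
  shows "card P + card A \<le> card (refine P A)"
proof -
  let ?T = "{c \<in> P. c \<inter> A \<noteq> {} \<and> c - A \<noteq> {}}"
  have fin: "finite P" using finite_elements[OF X P] .
  have "card A = (\<Sum>c\<in>P. card (c \<inter> A))" using sum_card_Int_partition[OF P X A] by simp
  also have "\<dots> \<le> (\<Sum>c\<in>P. if c \<in> ?T then 1 else 0)"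
  proof (rule sum_mono)
    fix c assume c: "c \<in> P"
    show "card (c \<inter> A) \<le> (if c \<in> ?T then 1 else 0)"
    proof (cases "card (c \<inter> A) = 1")
      case True
      then have "c \<inter> A \<noteq> {}" by auto
      then show ?thesis using split[OF c True] c True by simp
    next
      case False
      then show ?thesis using one[OF c] by simp
    qed
  qed
  also have "\<dots> = card ?T" using fin by (simp add: sum.If_cases Int_def)
  finally show ?thesis using card_refine[OF P X, of A] by simp
qed

text \<open>A piece of size \<open>M\<close> is a whole untouched cell, since touched cells of that
  size are cut. Comparison with it shows that \<open>A\<close> takes at most one point from any
  cell, and only from cells of size \<open>M\<close>; each point of \<open>A\<close> then cuts a
  cell.\<close>

lemma step_dichotomy:
  assumes P: "partition_on X P" and X: "finite X" and A: "A \<subseteq> X" and bal: "balanced P A"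
    and big: "3 * card A < card X" and M: "2 \<le> M" "\<And>c. c \<in> P \<Longrightarrow> card c \<le> M"
  shows "card P + card A \<le> card (refine P A) \<or> (\<forall>e\<in>refine P A. card e < M)"
proof (rule disjCI)
  assume "\<not> (\<forall>e\<in>refine P A. card e < M)"
  then obtain e where e: "e \<in> refine P A" "M \<le> card e" by (auto simp: not_less)
  then obtain c where c: "c \<in> P" "e = c \<inter> A \<or> e = c - A" by (elim refine_cellE) blast
  have fc: "finite c" using finite_cell[OF P X c(1)] .
  have "e \<subseteq> c" using c(2) by blast
  then have ec: "e = c" using card_subset_eq[OF fc, of e] card_mono[OF fc, of e] e(2) M(2)[OF c(1)] by linarith
  have cM: "card c = M" using ec e(2) M(2)[OF c(1)] by simp
  have "c - A \<noteq> {}" using touched_cell_split[OF P X A bal big c(1)] cM M(1) by simp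
  then have cA: "c \<inter> A = {}" using c(2) ec by blast
  have bound: "card (d \<inter> A) * (M + 1) \<le> card d + 1" if "d \<in> P" for d
    using balancedD[OF bal that c(1)] by (simp add: cA cM)
  show "card P + card A \<le> card (refine P A)"
  proof (rule card_A_le_card_split[OF P X A])
    fix d assume d: "d \<in> P"
    show "card (d \<inter> A) \<le> 1"
    proof (rule ccontr)
      assume "\<not> card (d \<inter> A) \<le> 1"
      then have "2 * (M + 1) \<le> card (d \<inter> A) * (M + 1)" by (intro mult_right_mono) simp_all
      from order_trans[OF this bound[OF d]] show False using M(2)[OF d] by presburger
    qed
    show "d - A \<noteq> {}" if "card (d \<inter> A) = 1"
      using bound[OF d] that M(1) touched_cell_split[OF P X A bal big d] by simp
  qed
qed

text \<open>This is the case that \<open>exchange_optimal_balanced\<close> leaves open. Unless the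
  refinement has at least \<open>card X - 1\<close> cells, two pairs stay uncut. In each comparison
  below one of them is spare: it is neither of the two cells compared, survives the exchange and
  secures the parity proviso.\<close>

lemma step_dichotomy_pairs:
  assumes P: "partition_on X P" and X: "finite X" and A: "A \<subseteq> X" and opt: "exchange_optimal P A"
    and big: "3 * card A < card X" and two: "\<And>c. c \<in> P \<Longrightarrow> card c \<le> 2"
    and few: "card {c \<in> P. 2 \<le> card c} \<le> card A"
  shows "card P + card A \<le> card (refine P A) \<or> card X - 1 \<le> card (refine P A)"
proof (rule disjCI)
  assume notfin: "\<not> card X - 1 \<le> card (refine P A)"
  let ?Q = "{c \<in> P. card c = 2}"
  let ?U = "{c \<in> ?Q. c \<inter> A = {} \<or> c - A = {}}"
  let ?T = "{c \<in> P. c \<inter> A \<noteq> {} \<and> c - A \<noteq> {}}"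
  have fin: "finite P" using finite_elements[OF X P] .
  have Qeq: "{c \<in> P. 2 \<le> card c} = ?Q" using two by force
  have pos: "1 \<le> card c" if "c \<in> P" for c using card_cell_pos[OF P X that] .
  have cardX: "card X = card P + card ?Q"
  proof -
    have "card X = (\<Sum>c\<in>P. card c)" using sum_card_partition[OF P X] by simp
    also have "\<dots> = (\<Sum>c\<in>P. 1 + (if card c = 2 then 1 else 0))"
    proof (rule sum.cong[OF refl])
      fix c assume "c \<in> P"
      from pos[OF this] two[OF this] show "card c = 1 + (if card c = 2 then 1 else 0)" by auto
    qed
    also have "\<dots> = card P + card ?Q" using fin by (simp add: sum.distrib sum.If_cases Int_def)
    finally show ?thesis .
  qed
  have "?T \<subseteq> ?Q"
  proof
    fix c assume c: "c \<in> ?T"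
    then have "finite c" using finite_cell[OF P X] by simp
    moreover from this have "card (c \<inter> A) \<noteq> 0" "card (c - A) \<noteq> 0" using c by auto
    ultimately have "2 \<le> card c" using card_Int_Diff[of c A] by linarith
    then show "c \<in> ?Q" using c two by force
  qed
  then have "?Q - ?T = ?U" "card (?Q - ?T) = card ?Q - card ?T"
    using fin by (auto simp: card_Diff_subset)
  then have "2 \<le> card ?U" using notfin cardX card_refine[OF P X, of A] by simp
  then obtain j1 j2 where j: "j1 \<in> ?U" "j2 \<in> ?U" "j1 \<noteq> j2"
  proof -
    obtain S where S: "S \<subseteq> ?U" "card S = 2" using \<open>2 \<le> card ?U\<close> by (meson obtain_subset_with_card_n)
    then obtain u v where "S = {u, v}" "u \<noteq> v" by (auto simp: card_2_iff)
    then show thesis using S(1) that[of u v] by blast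
  qed
  have exch: "card (c \<inter> A) * (card d + 1) \<le> (card c + 1) * (card (d \<inter> A) + 1)"
    if c: "c \<in> P" "x \<in> c \<inter> A" and d: "d \<in> P" "y \<in> d - A" and "c \<noteq> d"
      and k: "k \<in> ?U" "k \<noteq> c" "k \<noteq> d" for c d x y k
  proof -
    have "x \<notin> k" "y \<notin> k"
      using partition_on_disjoint[OF P c(1), of k] partition_on_disjoint[OF P d(1), of k] c d k by blast+
    then have "k \<inter> insert y (A - {x}) = k \<inter> A" "k - insert y (A - {x}) = k - A" by auto
    moreover have "k \<noteq> {}" using k by auto
    moreover have "k \<inter> A = {} \<and> k - A = k \<or> k - A = {} \<and> k \<inter> A = k" using k(1) by blast
    ultimately have "k \<in> refine P (insert y (A - {x}))"
      using k(1) in_refine_Int[of k P "insert y (A - {x})"] in_refine_Diff[of k P "insert y (A - {x})"]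
      by (elim disjE conjE) simp_all
    moreover have "2 \<le> card k" using k(1) by simp
    ultimately show ?thesis using opt c d \<open>c \<noteq> d\<close> unfolding exchange_optimal_def by blast
  qed
  have nosub: "i - A \<noteq> {}" if i: "i \<in> ?Q" for i
  proof
    assume sub: "i - A = {}"
    \<comment> \<open>There are \<open>card X - 2 * card ?Q\<close> singletons, more than
      \<open>card A\<close> by \<open>few\<close> and \<open>big\<close>.\<close>
    have "card A < card (P - ?Q)"
      using fin cardX few big by (simp add: Qeq card_Diff_subset)
    then obtain d where d: "d \<in> P - ?Q" "d \<inter> A = {}"
      using ex_untouched[OF P X A, of "P - ?Q"] by auto
    have cd: "card d = 1" using d pos[of d] two[of d] by force
    then obtain y where y: "y \<in> d" by fastforce
    have "i \<noteq> {}" using i by auto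
    then obtain x where x: "x \<in> i" by blast
    define k where "k = (if j1 = i then j2 else j1)"
    have k: "k \<in> ?U" "k \<noteq> i" using j unfolding k_def by presburger+
    have "card (i \<inter> A) * (card d + 1) \<le> (card i + 1) * (card (d \<inter> A) + 1)"
    proof (rule exch)
      show "i \<in> P" "x \<in> i \<inter> A" "d \<in> P" "y \<in> d - A" "i \<noteq> d" using i x sub d y by blast+
      show "k \<in> ?U" "k \<noteq> i" by (fact k)+
      show "k \<noteq> d" using k(1) d(1) by blast
    qed
    moreover have "i \<inter> A = i" using sub by blast
    ultimately show False using i d cd by simp
  qed
  have jA: "j1 \<inter> A = {}" using j(1) nosub[of j1] by simp
  have only: "card c = 2" if c: "c \<in> P" "c \<inter> A \<noteq> {}" for c
  proof (rule ccontr)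
    assume "card c \<noteq> 2"
    then have c1: "card c = 1" using pos[OF c(1)] two[OF c(1)] by linarith
    obtain x where x: "x \<in> c \<inter> A" using c(2) by blast
    have "j1 \<noteq> {}" using j(1) by auto
    then obtain y where y: "y \<in> j1 - A" using jA by blast
    have "card (c \<inter> A) * (card j1 + 1) \<le> (card c + 1) * (card (j1 \<inter> A) + 1)"
    proof (rule exch[OF c(1) x])
      show "j1 \<in> P" "y \<in> j1 - A" "j2 \<in> ?U" "j2 \<noteq> j1" using j y by blast+
      show "c \<noteq> j1" "j2 \<noteq> c" using j \<open>card c \<noteq> 2\<close> by blast+
    qed
    moreover have "card (c \<inter> A) \<noteq> 0" using c finite_cell[OF P X c(1)] by simp
    moreover have "card j1 = 2" using j(1) by simp
    ultimately show False using c1 jA by simp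
  qed
  show "card P + card A \<le> card (refine P A)"
  proof (rule card_A_le_card_split[OF P X A])
    fix c assume c: "c \<in> P"
    have fc: "finite c" using finite_cell[OF P X c] .
    show "card (c \<inter> A) \<le> 1"
    proof (cases "c \<inter> A = {}")
      case False
      then have "c \<in> ?Q" using only c by simp
      then have "card (c - A) \<noteq> 0" "card c = 2" using nosub[of c] fc by simp_all
      then show ?thesis using card_Int_Diff[OF fc, of A] by linarith
    qed simp
    show "c - A \<noteq> {}" if "card (c \<inter> A) = 1"
    proof -
      have "c \<inter> A \<noteq> {}" using that by auto
      then show ?thesis using only[OF c] nosub[of c] c by simp
    qed
  qed
qed

text \<open>A point of \<open>A\<close> outside \<open>B\<close> lies in a cell of at most
  \<open>r\<close> points and leaves at most \<open>r - 1\<close> points of \<open>A\<close> for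
  \<open>B\<close>. The comparison then reads \<open>card B + 1 <= (r + 1) * r\<close>, which is the
  origin of the threshold.\<close>

lemma step_large_rest:
  assumes P: "partition_on X P" and X: "finite X" and A: "A \<subseteq> X" "card A = r" and bal: "balanced P A"
    and B: "B \<in> P" "r * r + r \<le> card B" and le: "\<And>c. c \<in> P - {B} \<Longrightarrow> card c \<le> r"
  shows "A \<subseteq> B"
proof (rule ccontr)
  assume "\<not> A \<subseteq> B"
  then obtain x where x: "x \<in> A" "x \<notin> B" by blast
  then obtain c where c: "c \<in> P" "x \<in> c" using A partition_onD1[OF P] by blast
  have fA: "finite A" using finite_subset[OF A(1) X] .
  have "card (c \<inter> A) \<noteq> 0" using x c fA by auto
  then have "card B + 1 \<le> card (c \<inter> A) * (card B + 1)" by simp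
  also have "\<dots> \<le> (card c + 1) * (card (B \<inter> A) + 1)" by (rule balancedD[OF bal c(1) B(1)])
  also have "\<dots> \<le> (r + 1) * r"
  proof (rule mult_mono)
    show "card c + 1 \<le> r + 1" using le[of c] c x by auto
    have "card (B \<inter> A) < card A" using x by (intro psubset_card_mono[OF fA]) auto
    then show "card (B \<inter> A) + 1 \<le> r" using A(2) by simp
  qed simp_all
  finally show False using B(2) by (simp add: algebra_simps)
qed

text \<open>Let \<open>v\<close> be one more than the number of points not yet covered. A greedy step while the
  largest other cell has size \<open>s\<close> turns \<open>v\<close> into at most \<open>v s / (s + 1) + 1\<close>. Rounding down,
  three steps take \<open>s\<^sup>2 + s\<close> to \<open>s\<^sup>2 - 2 s + 4 \<le> (s - 1)\<^sup>2 + (s - 1)\<close> for \<open>s \<ge> 4\<close>; the index \<open>j\<close>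
  counts the steps spent on level \<open>s\<close>, and \<open>top_bound\<close> guarantees at least three of them.\<close>

definition rest_bound :: "nat \<Rightarrow> nat \<Rightarrow> nat \<Rightarrow> bool" where
  "rest_bound s j u \<longleftrightarrow>
     (if j = 0 then u + 1 \<le> s * s + s else if j = 1 then u \<le> s * s
      else if j = 2 then u + s \<le> s * s + 1 else u + 2 * s \<le> s * s + 3)"

definition top_bound :: "nat \<Rightarrow> nat \<Rightarrow> nat" where
  "top_bound r j = (if j = 0 then 2 * r + 1 else if j = 1 then r + 1 else 1)"

text \<open>Once all cells of size \<open>s\<close> have been touched, fewer than \<open>r\<close>
  of the \<open>3 * r\<close> cells counted here have dropped to \<open>s - 2\<close>. At least
  \<open>2 * r + 1\<close> then have size \<open>s - 1\<close>, as \<open>top_bound\<close> demands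
  at the start of a level. A step touches at most \<open>r\<close> cells, so these last for two
  steps and leave one for the third.\<close>

definition level :: "nat \<Rightarrow> nat \<Rightarrow> nat \<Rightarrow> 'a set set \<Rightarrow> 'a set \<Rightarrow> bool" where
  "level r s j P B \<longleftrightarrow> (\<forall>c\<in>P - {B}. card c \<le> s) \<and>
     3 * r \<le> card {c \<in> P - {B}. s - 1 \<le> card c} \<and>
     top_bound r j \<le> card {c \<in> P - {B}. card c = s} \<and> rest_bound s j (card B)"

text \<open>For \<open>j <= 2\<close>, either \<open>a\<close> alone achieves the drop required at
  this stage, or \<open>a\<close> is so small that \<open>u + 1 <= (s + 1) * (a + 1)\<close> by
  itself keeps \<open>u\<close> low enough.\<close>

lemma rest_bound_step:
  assumes "rest_bound s j u" "4 \<le> s" "a \<le> u" "u + 1 \<le> (s + 1) * (a + 1)"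
  shows "rest_bound s (j + 1) (u - a)"
proof -
  have 4: "u + 1 \<le> s * a + s + a + 1" using assms(4) by (simp add: algebra_simps)
  consider "j = 0" | "j = 1" | "j = 2" | "3 \<le> j" by linarith
  then show ?thesis
  proof cases
    case 1
    have u: "u + 1 \<le> s * s + s" using assms(1) 1 by (simp add: rest_bound_def)
    have "u \<le> s * s + a"
    proof (cases "s - 1 \<le> a")
      case False
      then have "s * (a + 2) \<le> s * s" using assms(2) by (intro mult_le_mono2) simp
      then have "s * a + 2 * s \<le> s * s" by (simp add: algebra_simps)
      then show ?thesis using 4 by linarith
    qed (use u in linarith)
    then show ?thesis using 1 by (simp add: rest_bound_def)
  next
    case 2
    have u: "u \<le> s * s" using assms(1) 2 by (simp add: rest_bound_def)
    have "u + s \<le> s * s + 1 + a"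
    proof (cases "s - 1 \<le> a")
      case False
      then have "s * (a + 2) \<le> s * s" using assms(2) by (intro mult_le_mono2) simp
      then have "s * a + 2 * s \<le> s * s" by (simp add: algebra_simps)
      then show ?thesis using 4 by linarith
    qed (use u in linarith)
    then show ?thesis using 2 assms(3) by (simp add: rest_bound_def)
  next
    case 3
    have u: "u + s \<le> s * s + 1" using assms(1) 3 by (simp add: rest_bound_def)
    have "u + 2 * s \<le> s * s + 3 + a"
    proof (cases "s - 2 \<le> a")
      case False
      then have "s * (a + 3) \<le> s * s" using assms(2) by (intro mult_le_mono2) simp
      then have "s * a + 3 * s \<le> s * s" by (simp add: algebra_simps)
      then show ?thesis using 4 by linarith
    qed (use u in linarith)
    then show ?thesis using 3 assms(3) by (simp add: rest_bound_def)
  next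
    case 4
    then show ?thesis using assms(1) by (simp add: rest_bound_def)
  qed
qed

lemma rest_bound_imp_0: "rest_bound s j u \<Longrightarrow> 4 \<le> s \<Longrightarrow> u + 1 \<le> s * s + s"
  by (auto simp: rest_bound_def split: if_splits)

lemma rest_bound_next: "rest_bound s j u \<Longrightarrow> 3 \<le> j \<Longrightarrow> 4 \<le> s \<Longrightarrow> rest_bound (s - 1) 0 u"
proof -
  assume a: "rest_bound s j u" "3 \<le> j" "4 \<le> s"
  then obtain t where s: "s = t + 4" by (metis add.commute le_Suc_ex)
  show ?thesis using a by (simp add: rest_bound_def s algebra_simps)
qed

text \<open>With \<open>a = card (B \<inter> A)\<close>, the other \<open>r - a\<close> points of
  \<open>A\<close> cut one cell each, which gives the first claim. For the second, if some cell of
  size \<open>s\<close> stays untouched, then only such cells were touched outside \<open>B\<close>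
  and the level persists; otherwise all of them shrank and the level drops.\<close>

lemma level_step:
  assumes P: "partition_on X P" and X: "finite X" and A: "A \<subseteq> X" "card A = r"
    and bal: "balanced P A" and B: "B \<in> P \<or> B = {}" and s: "4 \<le> s" "s \<le> r"
    and lev: "level r s j P B"
  shows "r + card (B - A) + card P \<le> card B + card (refine P A)"
    and "level r s (j + 1) (refine P A) (B - A) \<or> level r (s - 1) 0 (refine P A) (B - A)"
proof -
  let ?R = "refine P A" and ?Q = "P - {B}"
  have le: "card c \<le> s" if "c \<in> ?Q" for c using lev that by (simp add: level_def)
  have many: "3 * r \<le> card {c \<in> ?Q. s - 1 \<le> card c}"
    and top: "top_bound r j \<le> card {c \<in> ?Q. card c = s}"
    and rb: "rest_bound s j (card B)" using lev by (auto simp: level_def)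
  have finP: "finite P" using finite_elements[OF X P] .
  have finA: "finite A" using finite_subset[OF A(1) X] .
  have finc: "finite c" if "c \<in> P" for c using finite_cell[OF P X that] .
  have finB: "finite B" using B finc by auto
  define a where "a = card (B \<inter> A)"
  have cB: "card B = a + card (B - A)" unfolding a_def by (rule card_Int_Diff[OF finB])
  define T where "T = {c \<in> ?Q. c \<inter> A \<noteq> {}}"
  have finT: "finite T" using finP by (simp add: T_def)
  have TP: "T \<subseteq> P" by (auto simp: T_def)
  have untouched: "\<exists>c\<in>S. c \<inter> A = {}" if "S \<subseteq> P" "r < card S" for S
    using ex_untouched[OF P X A(1) that(1)] that(2) A(2) by simp
  \<comment> \<open>An untouched cell of size at least \<open>s - 1\<close> serves as reference:
    compared with it, no cell of size at most \<open>s\<close> can hold two points of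
    \<open>A\<close>, and a touched cell has at least \<open>s - 1\<close> points.\<close>
  have "r < card {c \<in> ?Q. s - 1 \<le> card c}" using many s by linarith
  then obtain q where q: "q \<in> ?Q" "s - 1 \<le> card q" "q \<inter> A = {}"
    using untouched[of "{c \<in> ?Q. s - 1 \<le> card c}"] by auto
  have bq: "card (c \<inter> A) * s \<le> card c + 1" if "c \<in> P" for c
  proof -
    have "card (c \<inter> A) * s \<le> card (c \<inter> A) * (card q + 1)" using q(2) by (intro mult_le_mono2) simp
    also have "\<dots> \<le> card c + 1" using balancedD[OF bal that, of q] q by simp
    finally show ?thesis .
  qed
  have one: "card (c \<inter> A) \<le> 1" if c: "c \<in> ?Q" for c
  proof (rule ccontr)
    assume "\<not> card (c \<inter> A) \<le> 1"
    then have "2 * s \<le> card (c \<inter> A) * s" by (intro mult_right_mono) simp_all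
    then have "2 * s \<le> card c + 1" using bq[of c] c by (meson DiffD1 order_trans)
    then show False using le[OF c] s by linarith
  qed
  have T1: "card (c \<inter> A) = 1" if "c \<in> T" for c
  proof -
    have "c \<in> ?Q" "c \<inter> A \<noteq> {}" using that by (auto simp: T_def)
    moreover from this have "card (c \<inter> A) \<noteq> 0" using finA by simp
    ultimately show ?thesis using one[of c] by linarith
  qed
  have cD: "card c = card (c - A) + (if c \<in> T then 1 else 0)" if "c \<in> ?Q" for c
  proof -
    have "card c = card (c \<inter> A) + card (c - A)" using finc that by (intro card_Int_Diff) simp
    moreover have "c \<inter> A = {}" if "c \<notin> T" using that \<open>c \<in> ?Q\<close> by (simp add: T_def)
    ultimately show ?thesis using T1[of c] by (cases "c \<in> T") simp_all
  qed
  have Tbig: "s - 1 \<le> card c" if "c \<in> T" for c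
  proof -
    have "c \<in> P" using that TP by blast
    then show ?thesis using bq[of c] T1[OF that] by simp
  qed
  have sumr: "r = a + card T"
  proof -
    have Q0: "(\<Sum>c\<in>?Q. card (c \<inter> A)) = card T"
    proof -
      have "(\<Sum>c\<in>?Q. card (c \<inter> A)) = (\<Sum>c\<in>?Q. if c \<in> T then 1 else 0)"
      proof (rule sum.cong[OF refl])
        fix c assume "c \<in> ?Q"
        then show "card (c \<inter> A) = (if c \<in> T then 1 else 0)"
          using T1[of c] by (cases "c \<in> T") (simp_all add: T_def)
      qed
      also have "\<dots> = card (?Q \<inter> T)" using finP by (simp add: sum.If_cases)
      also have "?Q \<inter> T = T" by (auto simp: T_def)
      finally show ?thesis .
    qed
    have "r = (\<Sum>c\<in>P. card (c \<inter> A))" using sum_card_Int_partition[OF P X A(1)] A(2) by simp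
    also have "\<dots> = a + (\<Sum>c\<in>?Q. card (c \<inter> A))"
    proof (cases "B \<in> P")
      case True
      then show ?thesis using finP by (simp add: sum.remove a_def)
    next
      case False
      then have "B = {}" "?Q = P" using B by auto
      then show ?thesis by (simp add: a_def)
    qed
    finally show ?thesis using Q0 by simp
  qed
  then have Tr: "card T \<le> r" by simp
  have nonempty: "c - A \<noteq> {}" if "c \<in> ?Q" "s - 1 \<le> card c" for c
  proof
    assume "c - A = {}"
    then have "card (c - A) = 0" by (simp only: card.empty)
    then have "card c \<le> 1" using cD[OF that(1)] by simp
    then show False using that(2) s by linarith
  qed
  have "T \<subseteq> {c \<in> P. c \<inter> A \<noteq> {} \<and> c - A \<noteq> {}}"
    using nonempty Tbig by (auto simp: T_def)
  then have "card T \<le> card {c \<in> P. c \<inter> A \<noteq> {} \<and> c - A \<noteq> {}}"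
    using finP by (intro card_mono) simp_all
  then show "r + card (B - A) + card P \<le> card B + card ?R"
    using card_refine[OF P X, of A] sumr cB by linarith
  have rb': "rest_bound s (j + 1) (card (B - A))"
  proof -
    have "card B + 1 \<le> (s + 1) * (a + 1)"
    proof (cases "T = {}")
      case True
      \<comment> \<open>Here all of \<open>A\<close> lies in \<open>B\<close>, so
        \<open>a = r\<close>.\<close>
      then have "s \<le> a" using sumr s by simp
      then have "(s + 1) * (s + 1) \<le> (s + 1) * (a + 1)" by (intro mult_le_mono2) simp
      then show ?thesis using rest_bound_imp_0[OF rb s(1)] by (simp add: algebra_simps)
    next
      case False
      then obtain c where c: "c \<in> T" by blast
      then have cQ: "c \<in> ?Q" by (simp add: T_def)
      show ?thesis
      proof (cases "B \<in> P")
        case True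
        have "card B + 1 \<le> (card c + 1) * (a + 1)"
          using balancedD[OF bal _ True, of c] cQ T1[OF c] by (simp add: a_def)
        also have "\<dots> \<le> (s + 1) * (a + 1)" using le[OF cQ] by (intro mult_le_mono1) simp
        finally show ?thesis .
      next
        case False
        then show ?thesis using B by (simp add: algebra_simps)
      qed
    qed
    then have "rest_bound s (j + 1) (card B - a)"
      by (intro rest_bound_step[OF rb s(1)]) (simp_all add: cB)
    then show ?thesis by (simp add: cB)
  qed
  have as: "a * s \<le> card B + 1"
    using bq[of B] B by (auto simp: a_def)
  \<comment> \<open>The piece \<open>B \<inter> A\<close> becomes an ordinary cell and must fit
    under the level: \<open>a <= s\<close> while the level persists, \<open>a < s\<close> when it
    drops, which happens only from \<open>j = 2\<close> on.\<close>
  have a_lt: "a < s" if "2 \<le> j"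
  proof (rule ccontr)
    assume "\<not> a < s"
    then have "s * s \<le> a * s" by (intro mult_le_mono1) simp
    then have "s * s \<le> card B + 1" using as by (rule order_trans)
    moreover have "card B + s \<le> s * s + 1"
      using rb that s(1) by (auto simp: rest_bound_def split: if_splits)
    ultimately show False using s(1) by linarith
  qed
  have a_le: "a \<le> s"
  proof -
    consider "j = 0" | "j = 1" | "2 \<le> j" by linarith
    then show ?thesis
    proof cases
      case 1
      then have "r < card {c \<in> ?Q. card c = s}" using top by (simp add: top_bound_def)
      then obtain w where w: "w \<in> ?Q" "card w = s" "w \<inter> A = {}"
        using untouched[of "{c \<in> ?Q. card c = s}"] by auto
      have "a * (s + 1) \<le> card B + 1"
      proof (cases "B \<in> P")
        case True
        then show ?thesis using balancedD[OF bal True, of w] w by (simp add: a_def)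
      next
        case False
        then show ?thesis using B by (simp add: a_def)
      qed
      also have "\<dots> \<le> s * (s + 1)" using rest_bound_imp_0[OF rb s(1)] by (simp add: algebra_simps)
      finally show ?thesis by (simp only: mult_le_cancel2)
    next
      case 2
      then have "card B \<le> s * s" using rb by (simp add: rest_bound_def)
      show ?thesis
      proof (rule ccontr)
        assume "\<not> a \<le> s"
        then have "(s + 1) * s \<le> a * s" by (intro mult_le_mono1) simp
        then have "(s + 1) * s \<le> card B + 1" using as by (rule order_trans)
        then show False using \<open>card B \<le> s * s\<close> s by (simp add: algebra_simps)
      qed
    next
      case 3
      then show ?thesis using a_lt by simp
    qed
  qed
  have new: "(\<exists>c\<in>?Q. e = c - A) \<or> card e \<le> 1 \<or> card e = a" if e: "e \<in> ?R - {B - A}" for e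
  proof -
    obtain c where c: "c \<in> P" "e = c \<inter> A \<or> e = c - A" using e by (auto elim: refine_cellE)
    show ?thesis
    proof (cases "c = B")
      case True
      then show ?thesis using c e by (auto simp: a_def)
    next
      case False
      then show ?thesis using c one[of c] by auto
    qed
  qed
  have inR: "c - A \<in> ?R - {B - A}" if "c \<in> ?Q" "s - 1 \<le> card c" for c
  proof -
    have ne: "c - A \<noteq> {}" using nonempty[OF that] .
    then obtain x where x: "x \<in> c" "x \<notin> A" by blast
    have "x \<notin> B" using x that(1) B partition_on_disjoint[OF P, of c B] by blast
    then have "c - A \<noteq> B - A" using x by blast
    then show ?thesis using in_refine_Diff[of c P A] ne that(1) by blast
  qed
  \<comment> \<open>Distinct large cells leave distinct nonempty remainders, so lower bounds on
    numbers of cells pass to the refinement.\<close>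
  have count: "card S \<le> card {e \<in> ?R - {B - A}. f (card e)}"
    if S: "S \<subseteq> {c \<in> ?Q. s - 1 \<le> card c}" and f: "\<And>c. c \<in> S \<Longrightarrow> f (card (c - A))" for S f
  proof (rule card_inj_on_le[where f = "\<lambda>c. c - A"])
    show "inj_on (\<lambda>c. c - A) S"
    proof (rule inj_onI)
      fix c d assume cd: "c \<in> S" "d \<in> S" "c - A = d - A"
      then have "c \<in> ?Q" "s - 1 \<le> card c" "d \<in> ?Q" using S by auto
      from nonempty[OF this(1,2)] obtain x where "x \<in> c - A" by blast
      then have "x \<in> c" "x \<in> d" using cd(3) by auto
      then show "c = d" using partition_on_disjoint[OF P, of c d] \<open>c \<in> ?Q\<close> \<open>d \<in> ?Q\<close> by blast
    qed
    show "(\<lambda>c. c - A) ` S \<subseteq> {e \<in> ?R - {B - A}. f (card e)}"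
    proof
      fix e assume "e \<in> (\<lambda>c. c - A) ` S"
      then obtain c where c: "c \<in> S" "e = c - A" by blast
      then have "c \<in> ?Q" "s - 1 \<le> card c" using S by auto
      from inR[OF this] show "e \<in> {e \<in> ?R - {B - A}. f (card e)}" using f[OF c(1)] c(2) by simp
    qed
    show "finite {e \<in> ?R - {B - A}. f (card e)}"
      using finite_elements[OF X partition_on_refine[OF P, of A]] by simp
  qed
  let ?S0 = "{c \<in> ?Q. s - 1 \<le> card c}" and ?Sp = "{c \<in> ?Q. card c = s}"
  have finS: "finite ?S0" "finite ?Sp" using finP by simp_all
  show "level r s (j + 1) ?R (B - A) \<or> level r (s - 1) 0 ?R (B - A)"
  proof (cases "\<exists>w\<in>?Sp. w \<inter> A = {}")
    case True
    then obtain w where w: "w \<in> ?Sp" "w \<inter> A = {}" by blast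
    have Ts: "card c = s" if "c \<in> T" for c
    proof -
      have "c \<in> P" "c \<in> ?Q" using that by (auto simp: T_def)
      then have "s \<le> card c" using balancedD[OF bal _, of c w] w T1[OF that] by simp
      then show ?thesis using le[OF \<open>c \<in> ?Q\<close>] by simp
    qed
    have "\<forall>e\<in>?R - {B - A}. card e \<le> s"
    proof
      fix e assume e: "e \<in> ?R - {B - A}"
      consider c where "c \<in> ?Q" "e = c - A" | "card e \<le> 1" | "card e = a" using new[OF e] by blast
      then show "card e \<le> s"
      proof cases
        case 1
        show ?thesis unfolding 1(2) using cD[OF 1(1)] le[OF 1(1)] by linarith
      qed (use a_le s in linarith)+
    qed
    moreover have "3 * r \<le> card {e \<in> ?R - {B - A}. s - 1 \<le> card e}"
    proof (rule order_trans[OF many], rule count)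
      fix c assume c: "c \<in> ?S0"
      then show "s - 1 \<le> card (c - A)" using cD[of c] Ts[of c] by (cases "c \<in> T") auto
    qed simp
    moreover have "top_bound r (j + 1) \<le> card {e \<in> ?R - {B - A}. card e = s}"
    proof -
      have "card (?Sp - T) \<le> card {e \<in> ?R - {B - A}. card e = s}"
      proof (rule count)
        fix c assume "c \<in> ?Sp - T"
        then show "card (c - A) = s" using cD[of c] by auto
      qed auto
      moreover have "card ?Sp \<le> card (?Sp - T) + r"
        using diff_card_le_card_Diff[OF finT, of ?Sp] Tr by linarith
      moreover have "1 \<le> card (?Sp - T)"
      proof -
        have "w \<in> ?Sp - T" using w by (simp add: T_def)
        then have "?Sp - T \<noteq> {}" by blast
        then have "0 < card (?Sp - T)" using finite_Diff[OF finS(2), of T] unfolding card_gt_0_iff by blast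
        then show ?thesis by simp
      qed
      ultimately show ?thesis using top by (auto simp: top_bound_def split: if_splits)
    qed
    ultimately show ?thesis using rb' unfolding level_def by blast
  next
    case False
    then have SpT: "?Sp \<subseteq> T" by (auto simp: T_def)
    then have "card ?Sp \<le> card T" using finT by (rule card_mono[rotated])
    then have Spr: "card ?Sp \<le> r" using Tr by linarith
    \<comment> \<open>For \<open>j < 2\<close> there are more than \<open>r\<close> cells of size
      \<open>s\<close>, too many to be touched in one step.\<close>
    have j: "2 \<le> j"
    proof (rule ccontr)
      assume "\<not> 2 \<le> j"
      then have "r + 1 \<le> top_bound r j" by (auto simp: top_bound_def)
      then show False using top Spr by linarith
    qed
    have "top_bound r j = 1" using j by (simp add: top_bound_def)
    then have "?Sp \<noteq> {}" using top by (metis card.empty not_one_le_zero)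
    then obtain w where w: "w \<in> ?Sp" by blast
    have lt: "card (c - A) \<le> s - 1" if "c \<in> ?Q" for c
      using cD[OF that] le[OF that] SpT that by (cases "card c = s") auto
    have "\<forall>e\<in>?R - {B - A}. card e \<le> s - 1"
    proof
      fix e assume e: "e \<in> ?R - {B - A}"
      consider c where "c \<in> ?Q" "e = c - A" | "card e \<le> 1" | "card e = a" using new[OF e] by blast
      then show "card e \<le> s - 1"
      proof cases
        case 1
        then show ?thesis using lt by simp
      qed (use a_lt[OF j] s in linarith)+
    qed
    moreover have "3 * r \<le> card {e \<in> ?R - {B - A}. s - 1 - 1 \<le> card e}"
    proof (rule order_trans[OF many], rule count)
      fix c assume c: "c \<in> ?S0"
      then show "s - 1 - 1 \<le> card (c - A)" using cD[of c] by (cases "c \<in> T") auto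
    qed simp
    moreover have "top_bound r 0 \<le> card {e \<in> ?R - {B - A}. card e = s - 1}"
    proof -
      let ?L = "{c \<in> T. card c = s - 1}"
      have "card (?S0 - ?L) \<le> card {e \<in> ?R - {B - A}. card e = s - 1}"
      proof (rule count)
        fix c assume c: "c \<in> ?S0 - ?L"
        then have cQ: "c \<in> ?Q" "s - 1 \<le> card c" by auto
        show "card (c - A) = s - 1"
        proof (cases "card c = s")
          case True
          then have "c \<in> T" using SpT cQ by blast
          then show ?thesis using cD[OF cQ(1)] True by simp
        next
          case False
          then have "card c = s - 1" using le[OF cQ(1)] cQ(2) by linarith
          then show ?thesis using cD[OF cQ(1)] c by auto
        qed
      qed auto
      moreover have "card ?L < r"
      proof -
        have "w \<in> T" "w \<notin> ?L" using w SpT s by auto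
        then have "card ?L < card T" by (intro psubset_card_mono[OF finT]) auto
        then show ?thesis using Tr by linarith
      qed
      moreover have "card ?S0 - card ?L \<le> card (?S0 - ?L)"
        using finT by (intro diff_card_le_card_Diff) simp
      ultimately have "2 * r + 1 \<le> card {e \<in> ?R - {B - A}. card e = s - 1}" using many by linarith
      then show ?thesis by (simp add: top_bound_def)
    qed
    moreover have "rest_bound (s - 1) 0 (card (B - A))"
      using rest_bound_next[OF rb'] j s by simp
    ultimately show ?thesis unfolding level_def by blast
  qed
qed

lemma card_partition_plus_cell:
  assumes P: "partition_on X P" and X: "finite X" and c: "c \<in> P"
  shows "card P + card c \<le> card X + 1"
proof -
  have fin: "finite P" using finite_elements[OF X P] .
  have "(\<Sum>d\<in>P - {c}. 1) \<le> (\<Sum>d\<in>P - {c}. card d)"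
    using card_cell_pos[OF P X] by (intro sum_mono) simp
  moreover have "card X = card c + (\<Sum>d\<in>P - {c}. card d)"
    using sum_card_partition[OF P X] sum.remove[OF fin c, of card] by simp
  ultimately show ?thesis using fin c by (simp add: card_Diff_singleton)
qed

text \<open>The 34 is \<open>17 * 2\<close> and matches the \<open>n - 2\<close> in the lower bound
  for bases. For \<open>r = 3\<close> the extra \<open>N\<close> has to be avoided: with it,
  \<open>m = 9\<close> and \<open>N = 9\<close> would admit \<open>T = 31\<close>, while
  \<open>5 * 4 * 31 + 34 = 654\<close> exceeds \<open>17 * 36 = 612\<close>.\<close>

lemma step_count_arith:
  fixes r n m N T :: nat
  assumes r: "3 \<le> r" and n: "n = m * r + N" and N: "r * r \<le> N" and m: "3 * r \<le> m"
    and T: "r * T + m + 3 \<le> r * m + n + 11 * r + (if r = 3 then 0 else N)"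
  shows "5 * (r + 1) * T + 34 \<le> 17 * n"
proof (cases "r = 3")
  case True
  then show ?thesis using assms by simp
next
  case False
  then have "4 \<le> r" using r by simp
  \<comment> \<open>With the slacks \<open>x\<close>, \<open>y\<close>, \<open>z\<close> the
    inequality 2 below compares polynomials whose difference has no negative coefficient.\<close>
  then obtain z where z: "r = z + 4" by (metis add.commute le_Suc_ex)
  obtain x where x: "m = 3 * r + x" using m le_Suc_ex by blast
  obtain y where y: "N = r * r + y" using N le_Suc_ex by blast
  have "r * T + (m + 3) \<le> r * m + n + 11 * r + N" using T False by simp
  then have 1: "5 * (r + 1) * (r * T + (m + 3)) \<le> 5 * (r + 1) * (r * m + n + 11 * r + N)"
    by (rule mult_le_mono2)
  have 2: "5 * (r + 1) * (r * m + n + 11 * r + N) + 34 * r \<le> 17 * n * r + 5 * (r + 1) * (m + 3)"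
    unfolding n x y z by (simp add: algebra_simps)
  have "(5 * (r + 1) * T + 34) * r = 5 * (r + 1) * (r * T) + 34 * r" by (simp add: algebra_simps)
  moreover have "5 * (r + 1) * (r * T + (m + 3)) = 5 * (r + 1) * (r * T) + 5 * (r + 1) * (m + 3)"
    by (rule add_mult_distrib2)
  ultimately have "(5 * (r + 1) * T + 34) * r \<le> 17 * n * r" using 1 2 by linarith
  then show ?thesis using r by (simp only: mult_le_cancel2)
qed

section \<open>The greedy process\<close>

text \<open>These assumptions are all that the count needs to know about the group, so
  \<open>Alt n\<close> and \<open>Sym n\<close> are treated at once.\<close>

locale greedy_run =
  fixes n r :: nat and bs :: "nat set list"
  assumes r3: "3 \<le> r" and n4: "4 * (r * r) \<le> n"
    and sub: "i < length bs \<Longrightarrow> bs ! i \<subseteq> {1..n}" "i < length bs \<Longrightarrow> card (bs ! i) = r"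
    and opt: "i < length bs \<Longrightarrow> exchange_optimal (cells n (take i bs)) (bs ! i)"
    and grow: "i < length bs \<Longrightarrow> card (cells n (take i bs)) + 1 \<le> card (cells n (take (Suc i) bs))"
    and final: "n - 1 \<le> card (cells n bs)"
begin

definition P :: "nat \<Rightarrow> nat set set" where "P i = cells n (take i bs)"
definition B :: "nat \<Rightarrow> nat set" where "B i = {1..n} - \<Union> (set (take i bs))"

lemma n_large: "3 * r < n" "1 \<le> n"
proof -
  have "4 * (3 * r) \<le> 4 * (r * r)" using r3 by (intro mult_le_mono mult_le_mono1) simp_all
  then show "3 * r < n" using n4 r3 by linarith
  then show "1 \<le> n" by simp
qed

lemma part: "partition_on {1..n} (P i)"
  unfolding P_def by (rule partition_on_cells[OF n_large(2)])

lemma fin_cells: "finite (P i)"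
  using finite_elements[OF _ part] by simp

lemma P_Suc: "i < length bs \<Longrightarrow> P (Suc i) = refine (P i) (bs ! i)"
  by (simp add: P_def cells_take_Suc)

lemma B_Suc: "i < length bs \<Longrightarrow> B (Suc i) = B i - bs ! i"
  by (auto simp: B_def take_Suc_conv_app_nth)

lemma B_cases: "i \<le> length bs \<Longrightarrow> B i \<in> P i \<or> B i = {}"
proof (induction i)
  case 0
  then show ?case by (simp add: B_def P_def)
next
  case (Suc i)
  then have i: "i < length bs" by simp
  have "B i \<in> P i \<or> B i = {}" using Suc by simp
  then show ?case unfolding P_Suc[OF i] B_Suc[OF i] using in_refine_Diff[of "B i" "P i" "bs ! i"] by auto
qed

lemma card_P_le: "card (P i) \<le> n"
  using card_partition_le[OF part, of i] by simp

lemma card_P_Suc: "i < length bs \<Longrightarrow> card (P i) + 1 \<le> card (P (Suc i))"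
  unfolding P_def by (rule grow)

text \<open>Each step adds a cell and there are never more than \<open>n\<close>. A partition at
  least two steps before the end therefore cannot be the exceptional outcome of
  \<open>step_dichotomy_pairs\<close>.\<close>

lemma card_P_early:
  assumes "i + 2 \<le> length bs"
  shows "card (P i) + 2 \<le> n"
proof -
  have "card (P i) + 1 \<le> card (P (Suc i))" "card (P (Suc i)) + 1 \<le> card (P (Suc (Suc i)))"
    using assms by (auto intro: card_P_Suc)
  then show ?thesis using card_P_le[of "Suc (Suc i)"] by linarith
qed

lemma before_end:
  assumes "i \<le> length bs" "c \<in> P i" "3 \<le> card c"
  shows "i < length bs"
proof (rule ccontr)
  assume "\<not> i < length bs"
  then have "n - 1 \<le> card (P i)" using final assms(1) by (simp add: P_def)
  then show False using card_partition_plus_cell[OF part _ assms(2)] assms(3) n_large(2) by simp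
qed

lemma bal:
  assumes "i < length bs" "(\<exists>c\<in>P i. 3 \<le> card c) \<or> r < card {c \<in> P i. 2 \<le> card c}"
  shows "balanced (P i) (bs ! i)"
proof (rule exchange_optimal_balanced[OF part finite_atLeastAtMost sub(1)[OF assms(1)]])
  show "exchange_optimal (P i) (bs ! i)" unfolding P_def by (rule opt[OF assms(1)])
  show "(\<exists>c\<in>P i. 3 \<le> card c) \<or> card (bs ! i) < card {c \<in> P i. 2 \<le> card c}"
    using assms(2) unfolding sub(2)[OF assms(1)] .
qed

section \<open>First phase: disjoint sets\<close>

lemma phase1:
  "t * r + r * r \<le> n \<Longrightarrow> t \<le> length bs \<and> card (B t) + t * r = n \<and> B t \<in> P t \<and>
     (\<forall>c\<in>P t - {B t}. card c = r) \<and> card (P t) = t + 1"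
proof (induction t)
  case 0
  then show ?case by (simp add: B_def P_def)
next
  case (Suc t)
  let ?A = "bs ! t" and ?R = "refine (P t) (bs ! t)"
  from Suc have IH: "t \<le> length bs" "card (B t) + t * r = n" "B t \<in> P t"
    "\<forall>c\<in>P t - {B t}. card c = r" "card (P t) = t + 1" by auto
  \<comment> \<open>The range of \<open>t\<close> is chosen so that the uncovered part still meets
    the threshold of \<open>step_large_rest\<close> here.\<close>
  have big: "r * r + r \<le> card (B t)" using Suc.prems IH(2) by simp
  then have B3: "3 \<le> card (B t)" using r3 by linarith
  have t: "t < length bs" using before_end[OF IH(1,3) B3] .
  note A = sub[OF t]
  have AB: "?A \<subseteq> B t"
  proof (rule step_large_rest[OF part _ A bal IH(3) big])
    show "(\<exists>c\<in>P t. 3 \<le> card c) \<or> r < card {c \<in> P t. 2 \<le> card c}" using IH(3) B3 by blast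
  qed (use t IH(4) in simp_all)
  have finA: "finite ?A" using A(1) finite_subset by blast
  have cB: "card (B t - ?A) + r = card (B t)"
    using card_Diff_subset[OF finA AB] card_mono[OF _ AB] A(2) by (simp add: B_def)
  have ne: "B t - ?A \<noteq> {}"
  proof
    assume "B t - ?A = {}"
    then have "card (B t - ?A) = 0" by (simp only: card.empty)
    then show False using cB big r3 by simp
  qed
  have Ane: "?A \<noteq> {}" using A(2) r3 by auto
  have dis: "c \<inter> ?A = {}" if "c \<in> P t - {B t}" for c
    using partition_on_disjoint[OF part, of c t "B t"] that IH(3) AB by blast
  have "{c \<in> P t. c \<inter> ?A \<noteq> {} \<and> c - ?A \<noteq> {}} = {B t}"
    using IH(3) dis ne Ane AB by blast
  then have card': "card ?R = t + 2" using card_refine[OF part, of t ?A] IH(5) by simp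
  have "card e = r" if e: "e \<in> ?R - {B t - ?A}" for e
  proof -
    obtain c where c: "c \<in> P t" "e = c \<inter> ?A \<or> e = c - ?A" "e \<noteq> {}" using e by (auto elim: refine_cellE)
    show ?thesis
    proof (cases "c = B t")
      case True
      then have "e = ?A" using c e AB by auto
      then show ?thesis using A(2) by simp
    next
      case False
      then have "c \<in> P t - {B t}" using c(1) by simp
      then have "e = c" using dis[of c] c by auto
      then show ?thesis using IH(4) \<open>c \<in> P t - {B t}\<close> by simp
    qed
  qed
  moreover have "B t - ?A \<in> ?R" using in_refine_Diff[OF IH(3) ne] .
  ultimately show ?case unfolding P_Suc[OF t] B_Suc[OF t] using t cB IH(2) card' by auto
qed

section \<open>Second phase: bringing the covered cells down to size 3\<close>

definition m :: nat where "m = (n - r * r) div r"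
definition N :: nat where "N = n - m * r"

text \<open>\<open>m\<close> is the largest \<open>t\<close> to which \<open>phase1\<close> applies.
  The bound \<open>N < r * r + r\<close> is the initial \<open>rest_bound\<close>, and
  \<open>3 * r <= m\<close>, a consequence of \<open>n4\<close>, provides the cells that
  \<open>level\<close> demands.\<close>

lemma m_N: "n = m * r + N" "r * r \<le> N" "N < r * r + r" "3 * r \<le> m"
proof -
  have "m * r + (n - r * r) mod r = n - r * r" by (simp add: m_def)
  moreover have "(n - r * r) mod r < r" using r3 by simp
  moreover have "r * r \<le> n" using n4 by simp
  ultimately show 1: "n = m * r + N" "r * r \<le> N" "N < r * r + r" by (simp_all add: N_def)
  show "3 * r \<le> m"
  proof (rule ccontr)
    assume "\<not> 3 * r \<le> m"
    then have "(m + 1) * r \<le> 3 * r * r" by (intro mult_le_mono1) simp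
    then show False using 1 n4 by (simp add: algebra_simps)
  qed
qed

lemma phase1_end:
  "m \<le> length bs" "card (B m) = N" "card (P m) = m + 1" "level r r 0 (P m) (B m)"
proof -
  have "m * r + r * r \<le> n" using m_N(1,2) by simp
  from phase1[OF this] have ph: "m \<le> length bs" "card (B m) + m * r = n" "B m \<in> P m"
     "\<forall>c\<in>P m - {B m}. card c = r" "card (P m) = m + 1" by auto
  then show "m \<le> length bs" "card (B m) = N" "card (P m) = m + 1" using m_N(1) by auto
  have "r - 1 \<le> card c" "card c = r" if "c \<in> P m - {B m}" for c using ph(4) that by simp_all
  then have "{c \<in> P m - {B m}. r - 1 \<le> card c} = P m - {B m}" "{c \<in> P m - {B m}. card c = r} = P m - {B m}"
    by blast+
  moreover have "card (P m - {B m}) = m" using ph(3,5) fin_cells by (simp add: card_Diff_singleton)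
  ultimately show "level r r 0 (P m) (B m)"
    unfolding level_def using ph(4) \<open>card (B m) = N\<close> m_N r3 by (simp add: top_bound_def rest_bound_def)
qed

text \<open>A step with \<open>a\<close> points in the uncovered part gains at least
  \<open>r - a\<close> cells. Including \<open>card (B t)\<close> makes the inequality invariant:
  the shortfall since \<open>m\<close> is at most \<open>N - card (B t)\<close>.\<close>

definition accounted :: "nat \<Rightarrow> bool" where
  "accounted t \<longleftrightarrow> m \<le> t \<and> t \<le> length bs \<and> r * (t - m) + card (B t) + m + 1 \<le> N + card (P t)"

lemma accounted_m: "accounted m"
  using phase1_end by (simp add: accounted_def)

lemma phase2:
  assumes "4 \<le> r"
  shows "(\<exists>t. accounted t \<and> level r 3 0 (P t) (B t)) \<or>
    (\<exists>s j. accounted (m + k) \<and> 4 \<le> s \<and> s \<le> r \<and> level r s j (P (m + k)) (B (m + k)))"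
proof (induction k)
  case 0
  show ?case using accounted_m assms phase1_end(4) by auto
next
  case (Suc k)
  then show ?case
  proof
    assume "\<exists>s j. accounted (m + k) \<and> 4 \<le> s \<and> s \<le> r \<and> level r s j (P (m + k)) (B (m + k))"
    then obtain s j where acc: "accounted (m + k)" and s: "4 \<le> s" "s \<le> r"
      and lev: "level r s j (P (m + k)) (B (m + k))" by blast
    let ?t = "m + k"
    have tl: "?t \<le> length bs" using acc by (simp add: accounted_def)
    have "0 < card {c \<in> P ?t - {B ?t}. s - 1 \<le> card c}" using lev r3 unfolding level_def by linarith
    then obtain c where c: "c \<in> P ?t" "s - 1 \<le> card c" by (auto simp: card_gt_0_iff)
    have c3: "3 \<le> card c" using c s by simp
    have t: "?t < length bs" using before_end[OF tl c(1) c3] .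
    have bl: "balanced (P ?t) (bs ! ?t)" using bal[OF t] c(1) c3 by blast
    note step = level_step[OF part finite_atLeastAtMost sub[OF t] bl B_cases[OF tl] s lev,
        folded P_Suc[OF t] B_Suc[OF t]]
    have acc': "accounted (Suc ?t)"
      using acc step(1) t by (simp add: accounted_def Suc_diff_le)
    from step(2) show ?thesis
    proof
      assume "level r s (j + 1) (P (Suc ?t)) (B (Suc ?t))"
      then show ?thesis using acc' s by auto
    next
      assume l: "level r (s - 1) 0 (P (Suc ?t)) (B (Suc ?t))"
      show ?thesis
      proof (cases "s = 4")
        case True
        then show ?thesis using l acc' by auto
      next
        case False
        then have "4 \<le> s - 1" "s - 1 \<le> r" using s by auto
        then show ?thesis using l acc' by auto
      qed
    qed
  qed blast
qed

text \<open>The 11 is \<open>3 * 3 + 3 - 1\<close>, from \<open>rest_bound\<close> at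
  \<open>s = 3\<close> and \<open>j = 0\<close>. For \<open>r = 3\<close> that level is already
  reached at \<open>m\<close>.\<close>

lemma phase2_end:
  obtains t where "accounted t" "\<forall>c\<in>P t. card c \<le> 11" "r = 3 \<Longrightarrow> t = m"
proof -
  have *: "\<exists>t. accounted t \<and> level r 3 0 (P t) (B t) \<and> (r = 3 \<longrightarrow> t = m)"
  proof (cases "r = 3")
    case True
    have "level r s 0 (P m) (B m)" if "s = r" for s using phase1_end(4) that by simp
    from this[OF True[symmetric]] show ?thesis using accounted_m by blast
  next
    case False
    then have "4 \<le> r" using r3 by simp
    \<comment> \<open>\<open>accounted\<close> forces \<open>t <= length bs\<close>, so for this
      \<open>k\<close> the second alternative of \<open>phase2\<close> is impossible.\<close>
    from phase2[OF this, of "length bs + 1"] show ?thesis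
      using False by (auto simp: accounted_def)
  qed
  then obtain t where t: "accounted t" "level r 3 0 (P t) (B t)" "r = 3 \<longrightarrow> t = m" by blast
  have "card c \<le> 11" if "c \<in> P t" for c
  proof (cases "c = B t")
    case True
    then show ?thesis using t(2) by (simp add: level_def rest_bound_def)
  next
    case False
    then have "card c \<le> 3" using t(2) that by (simp add: level_def)
    then show ?thesis by simp
  qed
  then show thesis using that t by blast
qed

section \<open>Third phase: small cells\<close>

text \<open>Each step raises \<open>r * k\<close> by \<open>r\<close>. Either the number of cells
  rises by at least \<open>r\<close> too, or \<open>M\<close> can be lowered by 1; both restore the
  inequality, which starts with \<open>M = 11\<close>.\<close>

lemma phase3:
  assumes t0: "\<forall>c\<in>P t0. card c \<le> 11"
  shows "t0 + k + 2 \<le> length bs \<Longrightarrow>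
    \<exists>M. 2 \<le> M \<and> (\<forall>c\<in>P (t0 + k). card c \<le> M) \<and> r * k + r * M + card (P t0) \<le> card (P (t0 + k)) + 11 * r"
proof (induction k)
  case 0
  show ?case using t0 by (intro exI[of _ 11]) simp
next
  case (Suc k)
  let ?t = "t0 + k"
  obtain M where M: "2 \<le> M" "\<forall>c\<in>P ?t. card c \<le> M"
    and acc: "r * k + r * M + card (P t0) \<le> card (P ?t) + 11 * r" using Suc by auto
  have t: "?t < length bs" using Suc.prems by simp
  note A = sub[OF t]
  have big: "3 * card (bs ! ?t) < card {1..n}" using A(2) n_large by simp
  have early: "card (P (Suc ?t)) + 2 \<le> n" using card_P_early[of "Suc ?t"] Suc.prems by simp
  have mono: "card (P ?t) \<le> card (P (Suc ?t))" using card_P_Suc[OF t] by simp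
  have "card (P ?t) + r \<le> card (P (Suc ?t)) \<or> (\<forall>e\<in>P (Suc ?t). card e < M)"
  proof (cases "(\<exists>c\<in>P ?t. 3 \<le> card c) \<or> r < card {c \<in> P ?t. 2 \<le> card c}")
    case True
    have "card (P ?t) + card (bs ! ?t) \<le> card (refine (P ?t) (bs ! ?t)) \<or> (\<forall>e\<in>refine (P ?t) (bs ! ?t). card e < M)"
      by (rule step_dichotomy[OF part _ A(1) bal[OF t True] big M(1)]) (use M(2) in simp_all)
    then show ?thesis using A(2) by (simp add: P_Suc[OF t])
  next
    case False
    then have two: "card c \<le> 2" if "c \<in> P ?t" for c using that by force
    have few: "card {c \<in> P ?t. 2 \<le> card c} \<le> card (bs ! ?t)" using False A(2) by simp
    have "card (P ?t) + card (bs ! ?t) \<le> card (refine (P ?t) (bs ! ?t)) \<or> card {1..n} - 1 \<le> card (refine (P ?t) (bs ! ?t))"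
      by (rule step_dichotomy_pairs[OF part _ A(1) opt[OF t, folded P_def] big two few]) simp
    moreover have "\<not> n - 1 \<le> card (refine (P ?t) (bs ! ?t))"
      using early unfolding P_Suc[OF t] by linarith
    ultimately show ?thesis using A(2) by (simp add: P_Suc[OF t])
  qed
  then show ?case
  proof
    assume a: "card (P ?t) + r \<le> card (P (Suc ?t))"
    have "card c \<le> M" if "c \<in> P (Suc ?t)" for c
    proof -
      obtain d where d: "d \<in> P ?t" "c = d \<inter> bs ! ?t \<or> c = d - bs ! ?t"
        using \<open>c \<in> P (Suc ?t)\<close> unfolding P_Suc[OF t] by (auto elim: refine_cellE)
      have "finite d" using finite_cell[OF part _ d(1)] by simp
      then have "card c \<le> card d" using d(2) by (intro card_mono) auto
      then show ?thesis using M(2) d(1) by force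
    qed
    then show ?thesis using M(1) a acc by (intro exI[of _ M]) simp
  next
    assume a: "\<forall>e\<in>P (Suc ?t). card e < M"
    have "\<exists>e\<in>P (Suc ?t). 2 \<le> card e"
    proof (rule ccontr)
      assume "\<not> ?thesis"
      then have "(\<Sum>e\<in>P (Suc ?t). card e) \<le> (\<Sum>e\<in>P (Suc ?t). 1)" by (intro sum_mono) force
      then show False using sum_card_partition[OF part, of "Suc ?t"] early by simp
    qed
    then have "3 \<le> M" using a by force
    define M' where "M' = M - 1"
    have M': "M = M' + 1" "2 \<le> M'" using \<open>3 \<le> M\<close> by (simp_all add: M'_def)
    have "\<forall>e\<in>P (t0 + Suc k). card e \<le> M'" using a M'(1) by force
    moreover have "r * Suc k + r * M' + card (P t0) \<le> card (P (t0 + Suc k)) + 11 * r"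
      using acc mono by (simp add: M'(1) algebra_simps)
    ultimately show ?thesis using M'(2) by blast
  qed
qed

lemma total_steps: "r * length bs + m + 3 \<le> r * m + n + 11 * r + (if r = 3 then 0 else N)"
proof -
  obtain t where t: "accounted t" "\<forall>c\<in>P t. card c \<le> 11" "r = 3 \<Longrightarrow> t = m"
    using phase2_end by blast
  have tl: "m \<le> t" "t \<le> length bs" and acc: "r * (t - m) + card (B t) + m + 1 \<le> N + card (P t)"
    using t(1) by (auto simp: accounted_def)
  have ph3: "r * (length bs - t) + card (P t) + 2 \<le> n + 11 * r"
  proof (cases "t + 2 \<le> length bs")
    case True
    then obtain k where k: "length bs = t + k + 2" by (metis add.assoc add.commute le_Suc_ex)
    obtain M where M: "2 \<le> M" "r * k + r * M + card (P t) \<le> card (P (t + k)) + 11 * r"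
      using phase3[OF t(2), of k] k by auto
    have "card (P (t + k)) + 2 \<le> n" using card_P_early[of "t + k"] k by simp
    \<comment> \<open>The remaining \<open>M >= 2\<close> pays for the two final steps, which
      \<open>phase3\<close> does not cover.\<close>
    moreover have "r * 2 \<le> r * M" using M(1) by (rule mult_le_mono2)
    moreover have "r * (length bs - t) = r * k + r * 2" unfolding k by (simp add: algebra_simps)
    ultimately show ?thesis using M(2) by linarith
  next
    case False
    then have "length bs - t \<le> 1" by simp
    then have "r * (length bs - t) \<le> r" using mult_le_mono2[of "length bs - t" 1 r] by (simp only: mult_1_right)
    then show ?thesis using card_P_le[of t] r3 by linarith
  qed
  have split: "r * length bs = r * (length bs - t) + r * (t - m) + r * m"
    using tl by (simp add: add_mult_distrib2[symmetric])
  show ?thesis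
  proof (cases "r = 3")
    case True
    then have "t = m" by (rule t(3))
    then have "r * (t - m) = 0" "card (P t) = m + 1" using phase1_end(3) by simp_all
    then have "r * length bs + m + 3 \<le> r * m + n + 11 * r" using ph3 split by linarith
    then show ?thesis by (simp add: trans_le_add1)
  next
    case False
    have "r * length bs + m + 3 \<le> r * m + n + 11 * r + N" using acc ph3 split by linarith
    then show ?thesis using False by simp
  qed
qed

lemma length_bound: "5 * (r + 1) * length bs + 34 \<le> 17 * n"
  using step_count_arith[OF r3 m_N(1,2,4) total_steps] .

end

theorem theorem2p10:
  fixes n r :: nat and G :: "(nat \<Rightarrow> nat) set"
  assumes "r \<ge> 1" and "n \<ge> 4 * r^2" and "G \<in> {Alt n, Sym n}"
  shows "real (greedy_size G set_act (rsubsets n r))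
           \<le> 17 / 10 * real (base_size G set_act (rsubsets n r))"
proof -
  have G: "Alt n \<subseteq> G" "G \<subseteq> Sym n" using assms(3) by (auto simp: Alt_def Sym_def)
  have n4: "4 * (r * r) \<le> n" using assms(2) by (simp add: power2_eq_square)
  have "r \<le> r * r" by (rule le_square)
  then have rn: "r < n" "1 \<le> n" "r \<le> n" using n4 assms(1) by linarith+
  define b where "b = base_size G set_act (rsubsets n r)"
  have b: "2 * (n - 2) \<le> b * (r + 1)"
    unfolding b_def by (rule base_size_lower_bound[OF G assms(1) rn(1)])
  obtain bs where bs: "greedy_base G set_act (rsubsets n r) bs"
    and len: "greedy_size G set_act (rsubsets n r) = length bs"
    using greedy_size_attained[OF G rn(2,3)] .
  have pre: "greedy_prefix G set_act (rsubsets n r) bs"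
    and triv: "acts_trivially (ptstab G set_act (set bs)) set_act (rsubsets n r)"
    using bs by (auto simp: greedy_base_iff)
  \<comment> \<open>Doubled, this reads
    \<open>10 * (r + 1) * length bs <= 17 * (2 * (n - 2))\<close>, that is, 17/10 of the lower bound
    for bases.\<close>
  have "5 * (r + 1) * length bs + 34 \<le> 17 * n"
  proof (cases "3 \<le> r")
    case True
    interpret greedy_run n r bs
    proof
      fix i assume i: "i < length bs"
      show "bs ! i \<subseteq> {1..n}" "card (bs ! i) = r"
        using greedy_prefix_nth[OF pre i] by (auto simp: rsubsets_def)
      have "in_largest_orbit (ptstab G set_act (set (take i bs))) set_act (rsubsets n r) (bs ! i)"
        using pre i by (simp add: greedy_prefix_def)
      then show "exchange_optimal (cells n (take i bs)) (bs ! i)"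
        by (rule largest_orbit_exchange_optimal[OF G greedy_prefix_subset[OF pre] rn(2)])
      show "card (cells n (take i bs)) + 1 \<le> card (cells n (take (Suc i) bs))"
        by (rule greedy_prefix_card_cells[OF G rn(2) pre i])
    qed (use True n4 trivial_ptstab_card_cells[OF G(1) assms(1) rn(1) triv] in simp_all)
    show ?thesis by (rule length_bound)
  next
    case False
    \<comment> \<open>For these \<open>r\<close> the length bound \<open>n - 1\<close> suffices,
      since \<open>n\<close> is at least 4 and 16 respectively.\<close>
    then have "r = 1 \<or> r = 2" using assms(1) by linarith
    moreover have "length bs \<le> n - 1" by (rule greedy_prefix_length[OF G rn(2) pre])
    ultimately show ?thesis using n4 by auto
  qed
  then have "5 * ((r + 1) * length bs) + 34 \<le> 17 * n" by (simp only: mult.assoc)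
  moreover have "17 * (2 * (n - 2)) \<le> 17 * (b * (r + 1))" using b by (rule mult_le_mono2)
  ultimately have "10 * ((r + 1) * length bs) \<le> 17 * (b * (r + 1))" by linarith
  then have "(10 * length bs) * (r + 1) \<le> (17 * b) * (r + 1)" by (simp add: algebra_simps)
  then have "10 * length bs \<le> 17 * b" by (simp only: mult_le_cancel2)
  then have "real (10 * length bs) \<le> real (17 * b)" by (simp only: of_nat_le_iff)
  then show ?thesis by (simp add: len b_def)
qed

end
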